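(* Consider a multi-armed bandit with $K$ arms. Each arm $j\in\{1,\dots,K\}$ has an underlying stationary Markov chain $\{X_{ji}\}_{i\geq1}$ with invariant probability measure $\pi_j$ and right spectral gap $1-\lambda_r>0$, and a measurable reward function $f_j$ with values in $[0,1]$. Whenever arm $j$ is played, it returns the reward of the current state of its chain and its chain then makes one transition, so that the $i$-th play of arm $j$ yields reward $f_j(X_{ji})$. Consider the $c$-UCB algorithm with input parameter $c$: with $\widehat{f}_{j,n}=\frac1n\sum_{i=1}^nf_j(X_{ji})$ the sample mean of the first $n$ rewards from arm $j$, at each round $t=1,2,\dots$ select $$j(t)\in\arg\max_{j=1}^K\ \widehat{f}_{j,N_j(t-1)}+\sqrt{\frac{c\log t}{2N_j(t-1)}},$$ where $N_j(s)=\sum_{t=1}^s\mathbb{I}(j(t)=j)$. If $c>2\alpha(\lambda_r\vee0)$, then the $c$-UCB algorithm has pseudo-regret over the first $T$ rounds $$\mathcal{R}\leq\sum_{j:\,\Delta_j>0}\left(\frac{2c}{\Delta_j}\log T+\frac{c\,\Delta_j}{c-2\alpha(\lambda_r\vee0)}\right).$$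
   Context: Let $j_\star$ be an arm with maximal expected stationary reward $\pi_j(f_j):=\int f_j\,d\pi_j$, and let $\Delta_j=\pi_{j_\star}(f_{j_\star})-\pi_j(f_j)\ge0$. The pseudo-regret on the first $T$ rounds is $\mathcal{R}=\sum_{j=1}^K\Delta_j\,\mathbb{E}N_j(T)$. When $N_j(t-1)=0$ the index of arm $j$ is taken to be $+\infty$. State spaces are standard Borel. For a time-homogeneous chain with transition kernel $P$ invariant with $\pi$, viewed as the operator $Ph(x)=\int h(y)P(x,dy)$ on the real Hilbert space $\mathcal{L}_2(\pi)$ (inner product $\langle\cdot,\cdot\rangle_\pi$, norm $\|\cdot\|_\pi$) with adjoint $P^*$, and $R=(P+P^* )/2$, the chain has right spectral gap $1-\lambda_r$ if $\lambda_r=\sup\{\langle Rh,h\rangle_\pi:\|h\|_\pi=1,\ \pi(h)=0\}<1$. Stationary means that the initial law is the invariant measure. $\alpha(\lambda)=\frac{1+\lambda}{1-\lambda}$; $\xi_1\vee\xi_2=\max\{\xi_1,\xi_2\}$. *)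

theory Defs
  imports "HOL-Probability.Probability"
begin

definition standard_borel :: "'a measure \<Rightarrow> bool" where
  "standard_borel S \<longleftrightarrow>
     (\<exists>X. completely_metrizable_space X \<and> second_countable X \<and> topspace X = space S \<and>
          sets S = sigma_sets (space S) {U. openin X U})"

definition past :: "'w measure \<Rightarrow> 'a measure \<Rightarrow> (nat \<Rightarrow> 'w \<Rightarrow> 'a) \<Rightarrow> nat \<Rightarrow> 'w measure" where
  "past M S X n = sigma (space M) (\<Union>i\<in>{1..n}. {X i -` A \<inter> space M |A. A \<in> sets S})"

(* The chain is indexed by i \<ge> 1; X 0 is irrelevant.  The Markov property is stated with respect
   to the natural filtration of the chain. *)
definition stationary_markov_chain ::
  "'w measure \<Rightarrow> 'a measure \<Rightarrow> ('a \<Rightarrow> 'a measure) \<Rightarrow> 'a measure \<Rightarrow> (nat \<Rightarrow> 'w \<Rightarrow> 'a) \<Rightarrow> bool" where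
  "stationary_markov_chain M S P \<pi> X \<longleftrightarrow>
     P \<in> S \<rightarrow>\<^sub>M prob_algebra S \<and> \<pi> \<in> space (prob_algebra S) \<and> \<pi> \<bind> P = \<pi> \<and>
     (\<forall>i\<ge>1. X i \<in> M \<rightarrow>\<^sub>M S) \<and> distr M S (X 1) = \<pi> \<and>
     (\<forall>n\<ge>1. \<forall>A\<in>sets S.
        AE \<omega> in M. real_cond_exp M (past M S X n) (\<lambda>\<omega>. indicator A (X (Suc n) \<omega>)) \<omega>
                    = measure (P (X n \<omega>)) A)"

(* Elements of the Hilbert space are represented by functions instead of classes of functions
   modulo a.e. equality. *)
definition L2 :: "'a measure \<Rightarrow> ('a \<Rightarrow> real) set" where
  "L2 \<pi> = {h \<in> borel_measurable \<pi>. integrable \<pi> (\<lambda>x. (h x)\<^sup>2)}"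

definition L2_inner :: "'a measure \<Rightarrow> ('a \<Rightarrow> real) \<Rightarrow> ('a \<Rightarrow> real) \<Rightarrow> real" where
  "L2_inner \<pi> g h = (\<integral>x. g x * h x \<partial>\<pi>)"

definition L2_norm :: "'a measure \<Rightarrow> ('a \<Rightarrow> real) \<Rightarrow> real" where
  "L2_norm \<pi> h = sqrt (L2_inner \<pi> h h)"

definition transition_op :: "('a \<Rightarrow> 'a measure) \<Rightarrow> ('a \<Rightarrow> real) \<Rightarrow> 'a \<Rightarrow> real" where
  "transition_op P h x = (\<integral>y. h y \<partial>P x)"

(* For a bounded operator A on L2, a function as below exists and is a.e. unique (Riesz), so the
   choice made by SOME does not affect inner products. *)
definition L2_adjoint ::
  "'a measure \<Rightarrow> (('a \<Rightarrow> real) \<Rightarrow> 'a \<Rightarrow> real) \<Rightarrow> ('a \<Rightarrow> real) \<Rightarrow> 'a \<Rightarrow> real" where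
  "L2_adjoint \<pi> A g =
     (SOME k. k \<in> L2 \<pi> \<and> (\<forall>h\<in>L2 \<pi>. L2_inner \<pi> (A h) g = L2_inner \<pi> h k))"

definition additive_reversibilization ::
  "'a measure \<Rightarrow> ('a \<Rightarrow> 'a measure) \<Rightarrow> ('a \<Rightarrow> real) \<Rightarrow> 'a \<Rightarrow> real" where
  "additive_reversibilization \<pi> P h x =
     (transition_op P h x + L2_adjoint \<pi> (transition_op P) h x) / 2"

(* has_right_spectral_gap \<pi> P l means that the chain has right spectral gap 1 - l.  The supremum
   is taken in the extended reals because no h qualifies if \<pi> only takes the values 0 and 1;
   then l is minus infinity. *)
definition has_right_spectral_gap :: "'a measure \<Rightarrow> ('a \<Rightarrow> 'a measure) \<Rightarrow> ereal \<Rightarrow> bool" where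
  "has_right_spectral_gap \<pi> P l \<longleftrightarrow>
     l = (SUP h\<in>{h \<in> L2 \<pi>. L2_norm \<pi> h = 1 \<and> (\<integral>x. h x \<partial>\<pi>) = 0}.
            ereal (L2_inner \<pi> (additive_reversibilization \<pi> P h) h)) \<and>
     l < 1"

definition alpha :: "real \<Rightarrow> real" where
  "alpha l = (1 + l) / (1 - l)"

(* Arms are numbered 1, ..., K, rounds 1, 2, ...; J t is the arm selected in round t. *)

definition sample_mean ::
  "(nat \<Rightarrow> 'a \<Rightarrow> real) \<Rightarrow> (nat \<Rightarrow> nat \<Rightarrow> 'w \<Rightarrow> 'a) \<Rightarrow> nat \<Rightarrow> nat \<Rightarrow> 'w \<Rightarrow> real" where
  "sample_mean f X j n \<omega> = (\<Sum>i=1..n. f j (X j i \<omega>)) / real n"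

definition num_plays :: "(nat \<Rightarrow> 'w \<Rightarrow> nat) \<Rightarrow> nat \<Rightarrow> nat \<Rightarrow> 'w \<Rightarrow> nat" where
  "num_plays J j s \<omega> = (\<Sum>t=1..s. if J t \<omega> = j then 1 else 0)"

definition ucb_index ::
  "real \<Rightarrow> (nat \<Rightarrow> 'a \<Rightarrow> real) \<Rightarrow> (nat \<Rightarrow> nat \<Rightarrow> 'w \<Rightarrow> 'a) \<Rightarrow> (nat \<Rightarrow> 'w \<Rightarrow> nat) \<Rightarrow>
     nat \<Rightarrow> 'w \<Rightarrow> nat \<Rightarrow> ereal" where
  "ucb_index c f X J t \<omega> j =
     (let n = num_plays J j (t - 1) \<omega> in
      if n = 0 then \<infinity>
      else ereal (sample_mean f X j n \<omega> + sqrt (c * ln (real t) / (2 * real n))))"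

(* Ties may be broken by any measurable rule. *)
definition ucb_algorithm ::
  "'w measure \<Rightarrow> nat \<Rightarrow> real \<Rightarrow> (nat \<Rightarrow> 'a \<Rightarrow> real) \<Rightarrow> (nat \<Rightarrow> nat \<Rightarrow> 'w \<Rightarrow> 'a) \<Rightarrow>
     (nat \<Rightarrow> 'w \<Rightarrow> nat) \<Rightarrow> bool" where
  "ucb_algorithm M K c f X J \<longleftrightarrow>
     (\<forall>t\<ge>1. J t \<in> M \<rightarrow>\<^sub>M count_space UNIV \<and>
        (\<forall>\<omega>\<in>space M. is_arg_max (ucb_index c f X J t \<omega>) (\<lambda>j. j \<in> {1..K}) (J t \<omega>)))"

definition mean_reward :: "(nat \<Rightarrow> 'a measure) \<Rightarrow> (nat \<Rightarrow> 'a \<Rightarrow> real) \<Rightarrow> nat \<Rightarrow> real" where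
  "mean_reward \<pi> f j = (\<integral>x. f j x \<partial>\<pi> j)"

definition reward_gap ::
  "(nat \<Rightarrow> 'a measure) \<Rightarrow> (nat \<Rightarrow> 'a \<Rightarrow> real) \<Rightarrow> nat \<Rightarrow> nat \<Rightarrow> real" where
  "reward_gap \<pi> f jstar j = mean_reward \<pi> f jstar - mean_reward \<pi> f j"

definition pseudo_regret ::
  "'w measure \<Rightarrow> nat \<Rightarrow> (nat \<Rightarrow> 'a measure) \<Rightarrow> (nat \<Rightarrow> 'a \<Rightarrow> real) \<Rightarrow> nat \<Rightarrow>
     (nat \<Rightarrow> 'w \<Rightarrow> nat) \<Rightarrow> nat \<Rightarrow> real" where
  "pseudo_regret M K \<pi> f jstar J T =
     (\<Sum>j=1..K. reward_gap \<pi> f jstar j * (\<integral>\<omega>. real (num_plays J j T \<omega>) \<partial>M))"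

end

(*
The sample means of an arm obey a Hoeffding inequality with variance factor alpha, although the chain
need not be reversible; the regret bound then follows from the usual UCB argument.

Let T be the transition operator and T_w the operator h |-> T (w h) with w = exp (s f).  The moment
generating function of the sum of the first n rewards is the integral of w * T_w^(n-1) 1.  As T is
not self-adjoint, a bound on the quadratic form of T_w does not bound the norm of its powers.  It does
bound its numerical radius because T_w is positive, and numerical radii satisfy Berger's power
inequality; for positive operators this has a short proof over the reals by summing cyclically over
the iterates.  Hence only the symmetric part of T matters, and the right spectral gap reduces its
quadratic form to that of l I + (1 - l) E_pi.  The tilted version of the latter is bounded by
convexity in f and the two-point case.
*)
theory Submission
  imports Defs
begin

section \<open>The two-point Leon-Perron bound\<close>

text \<open>Three choices shape the constants. Truncating the gap parameter at 0 makes
  \<open>t / (r - l * t)\<close> convex in \<open>t\<close>, whereas a negative \<open>l\<close>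
  would make it concave. This convexity is what reduces a general reward to one with values 0 and 1
  and the same mean. The factor \<open>alpha l\<close> fits because
  \<open>(1 - l) * alpha l = 1 + l\<close> clears the only nonlinear dependence on \<open>l\<close>
  in the two-point inequality. Finally, the play counts are random and depend on the rewards, so the
  tail bound \<open>t powr - (c / alpha l)\<close> of round \<open>t\<close> is summed over all
  possible counts below \<open>t\<close>. The factor \<open>t\<close> lost there is why
  \<open>c\<close> is compared with \<open>2 * alpha l\<close> and not with
  \<open>alpha l\<close>.\<close>

lemma tanh_half_less:
  fixes y :: real
  assumes "0 < y"
  shows "exp y - 1 < y / 2 * (exp y + 1)"
proof -
  \<comment> \<open>Divided by \<open>exp y + 1\<close>, the claim reads
    \<open>tanh (y / 2) < y / 2\<close>; \<open>g\<close> is the cleared difference, which vanishes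
    at 0.\<close>
  define g where "g y = y / 2 * (exp y + 1) - (exp y - 1)" for y :: real
  have "g 0 < g y"
  proof (rule DERIV_pos_imp_increasing_open[OF assms])
    fix x :: real assume x: "0 < x"
    have "(g has_real_derivative (1 - exp x + x * exp x) / 2) (at x)"
      unfolding g_def by (auto intro!: derivative_eq_intros simp: field_simps)
    moreover have "1 - x < exp (-x)"
      using exp_ge_add_one_self[of "-x"] x exp_minus_greater[of "x"] by simp
    then have "(1 - x) * exp x < exp (-x) * exp x" by simp
    then have "0 < (1 - exp x + x * exp x) / 2"
      by (simp add: exp_minus field_simps)
    ultimately show "\<exists>d. (g has_real_derivative d) (at x) \<and> 0 < d" by blast
  next
    show "continuous_on {0..y} g" unfolding g_def by (intro continuous_intros) simp_all
  qed
  then show ?thesis by (simp add: g_def)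
qed

text \<open>The left side is the moment generating function of a Bernoulli variable of mean
  \<open>p\<close>.\<close>

lemma Hoeffding_two_point:
  fixes p s :: real
  assumes "0 \<le> p" "p \<le> 1" "0 < s"
  shows "1 - p + p * exp s \<le> exp (s * p + s\<^sup>2 / 8)"
proof -
  have "- s * p + ln (1 + p * (exp s - 1)) \<le> s\<^sup>2 / 8"
    using Hoeffdings_lemma_aux[of s p] assms by simp
  moreover have pos: "0 < 1 + p * (exp s - 1)" using assms by (simp add: add_pos_nonneg)
  ultimately have "1 + p * (exp s - 1) \<le> exp (s * p + s\<^sup>2 / 8)"
    by (subst ln_le_cancel_iff[symmetric]) auto
  then show ?thesis by (simp add: algebra_simps)
qed

lemma alpha_ge_1: "0 \<le> l \<Longrightarrow> l < 1 \<Longrightarrow> 1 \<le> alpha l"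
  by (simp add: alpha_def field_simps)

text \<open>This keeps the denominators \<open>\<rho> - l * exp s\<close> positive. For
  \<open>y = - ln l\<close> one has \<open>tanh (y / 2) = 1 / alpha l\<close>, hence
  \<open>2 / alpha l < y\<close>, while \<open>s - alpha l * s\<^sup>2 / 8\<close> is at most
  \<open>2 / alpha l\<close> because the difference is a square.\<close>

lemma ratio_bound_below:
  fixes l s :: real
  assumes l: "0 \<le> l" "l < 1"
  shows "l * exp s < exp (alpha l * s\<^sup>2 / 8)"
proof (cases "l = 0")
  case False
  then have l0: "0 < l" using l by simp
  define a where "a = alpha l"
  have a: "1 \<le> a" unfolding a_def using l by (rule alpha_ge_1)
  define y where "y = - ln l"
  have "0 < y" unfolding y_def using l0 l by simp
  from tanh_half_less[OF this] have "1 / l - 1 < y / 2 * (1 / l + 1)"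
    using l0 by (simp add: y_def exp_minus inverse_eq_divide)
  then have "l * (1 / l - 1) < l * (y / 2 * (1 / l + 1))" using l0 by simp
  then have "1 - l < y / 2 * (1 + l)" using l0 by (simp add: algebra_simps)
  then have "2 / a < y" unfolding a_def alpha_def using l l0 by (simp add: field_simps)
  moreover have "s \<le> a * s\<^sup>2 / 8 + 2 / a"
  proof -
    have "0 \<le> (a * s - 4)\<^sup>2 / (8 * a)" using a by simp
    also have "\<dots> = a * s\<^sup>2 / 8 + 2 / a - s"
      using a by (simp add: field_simps power2_eq_square)
    finally show ?thesis by simp
  qed
  ultimately have "ln l + s < a * s\<^sup>2 / 8" by (simp add: y_def)
  then have "exp (ln l + s) < exp (a * s\<^sup>2 / 8)" by simp
  then show ?thesis using l0 by (simp add: exp_add a_def)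
qed simp

text \<open>For \<open>m = (ln \<rho> - alpha l * s\<^sup>2 / 8) / s\<close> with \<open>\<rho>\<close> fixed, both sides are affine in \<open>l\<close>, so it
  suffices to check the endpoints: \<open>l = 0\<close> is Hoeffding's lemma and \<open>l = 1\<close> is \<open>tanh x \<le> x\<close>.\<close>
lemma Leon_Perron_affine:
  fixes l s m :: real
  defines "\<rho> \<equiv> exp (s * m + alpha l * s\<^sup>2 / 8)"
  assumes l: "0 \<le> l" "l < 1" and s: "0 < s" and m: "0 \<le> m" and le: "\<rho> < exp s"
  shows "(1 - l) * (exp s - 1) * m \<le> \<rho> + l * exp s / \<rho> - l * exp s - 1"
proof -
  define q where "q = s * m + alpha l * s\<^sup>2 / 8"
  have q: "0 \<le> q" "q < s"
    using le m s alpha_ge_1[OF l] unfolding \<rho>_def q_def by simp_all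
  have r: "\<rho> = exp q" unfolding \<rho>_def q_def ..
  define t where "t = exp (s / 2)"
  have t2: "exp s = t * t" unfolding t_def by (simp flip: exp_add)
  have t1: "1 < t" unfolding t_def using s by simp
  have h0: "(exp s - 1) * (q / s - s / 8) \<le> \<rho> - 1"
  proof -
    \<comment> \<open>Endpoint \<open>l = 0\<close>: \<open>p\<close> is the Bernoulli mean whose
      moment generating function at \<open>s\<close> equals \<open>\<rho>\<close>.\<close>
    define p where "p = (exp q - 1) / (exp s - 1)"
    have p: "0 \<le> p" "p \<le> 1" "1 - p + p * exp s = exp q"
    proof -
      have "0 < exp s - 1" using s by simp
      then show "0 \<le> p" "p \<le> 1" unfolding p_def using q by (simp_all add: divide_le_eq_1)
      have "p * (exp s - 1) = exp q - 1" unfolding p_def using \<open>0 < exp s - 1\<close> by simp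
      then show "1 - p + p * exp s = exp q" by (simp add: algebra_simps)
    qed
    from Hoeffding_two_point[OF p(1,2) s] have "q \<le> s * p + s\<^sup>2 / 8"
      unfolding p(3) by simp
    then have "q / s - s / 8 \<le> p" using s by (simp add: field_simps power2_eq_square)
    then have "(exp s - 1) * (q / s - s / 8) \<le> (exp s - 1) * p" using s by simp
    also have "\<dots> = \<rho> - 1" unfolding p_def r using s by simp
    finally show ?thesis .
  qed
  have h1: "- ((exp s - 1) * s / 4) \<le> \<rho> + exp s / \<rho> - exp s - 1"
  proof -
    have "t - 1 \<le> s / 4 * (t + 1)"
      using tanh_half_less[of "s / 2"] s unfolding t_def by simp
    then have "(t - 1) * (t - 1) \<le> (t - 1) * (s / 4 * (t + 1))"
      using t1 by (intro mult_left_mono) auto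
    then have "(t - 1) * (t - 1) \<le> (exp s - 1) * s / 4" by (simp add: t2 algebra_simps)
    \<comment> \<open>Endpoint \<open>l = 1\<close>: the sum of \<open>\<rho>\<close> and
      \<open>exp s / \<rho>\<close> is smallest at the geometric mean \<open>t\<close> of 1 and
      \<open>exp s\<close>, and the remaining value is controlled by the tanh inequality at
      \<open>s / 2\<close>.\<close>
    moreover have "\<rho> + exp s / \<rho> - exp s - 1 = (\<rho> - t)\<^sup>2 / \<rho> - (t - 1) * (t - 1)"
      unfolding t2 r by (simp add: field_simps power2_eq_square)
    moreover have "0 \<le> (\<rho> - t)\<^sup>2 / \<rho>" unfolding r by simp
    ultimately show ?thesis by linarith
  qed
  have "(1 - l) * m = (1 - l) * (q / s - s / 8) - l * (s / 4)"
  proof -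
    have "m = q / s - alpha l * s / 8"
      unfolding q_def using s by (simp add: field_simps power2_eq_square)
    moreover have "(1 - l) * alpha l = 1 + l" using l by (simp add: alpha_def)
    then have "(1 - l) * (alpha l * s / 8) = (1 + l) * s / 8" by (simp flip: mult.assoc)
    ultimately have "(1 - l) * m = (1 - l) * (q / s) - (1 + l) * s / 8"
      by (simp only: right_diff_distrib)
    also have "\<dots> = (1 - l) * (q / s - s / 8) - l * (s / 4)"
      by (simp add: right_diff_distrib) (simp add: field_simps)
    finally show ?thesis .
  qed
  then have "(1 - l) * (exp s - 1) * m
      = (1 - l) * ((exp s - 1) * (q / s - s / 8)) + l * (- ((exp s - 1) * s / 4))"
    by algebra
  also have "\<dots> \<le> (1 - l) * (\<rho> - 1) + l * (\<rho> + exp s / \<rho> - exp s - 1)"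
    using h0 h1 l by (intro add_mono mult_left_mono) auto
  also have "\<dots> = \<rho> + l * exp s / \<rho> - l * exp s - 1" by (simp add: algebra_simps)
  finally show ?thesis .
qed

text \<open>This says that \<open>\<rho>\<close> dominates the largest eigenvalue of the operator
  \<open>h \<mapsto> exp (s f) * (l * h + (1 - l) * \<integral>h)\<close> on two points, where \<open>f\<close> takes the values 0 and 1 and has
  mean \<open>m\<close>.\<close>
lemma Leon_Perron_two_point:
  fixes l s m :: real
  defines "\<rho> \<equiv> exp (s * m + alpha l * s\<^sup>2 / 8)"
  assumes l: "0 \<le> l" "l < 1" and s: "0 < s" and m: "0 \<le> m" "m \<le> 1"
  shows "l * exp s < \<rho>"
    and "(1 - l) * (m * (exp s / (\<rho> - l * exp s)) + (1 - m) * (1 / (\<rho> - l))) \<le> 1"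
proof -
  have "exp (alpha l * s\<^sup>2 / 8) \<le> \<rho>" unfolding \<rho>_def using s m by simp
  with ratio_bound_below[OF l, of s] show less: "l * exp s < \<rho>" by simp
  have "1 \<le> exp (alpha l * s\<^sup>2 / 8)" using alpha_ge_1[OF l] by simp
  with \<open>_ \<le> \<rho>\<close> have "1 \<le> \<rho>" by linarith
  have s1: "1 < exp s" using s by simp
  note pos = less \<open>1 \<le> \<rho>\<close>
  \<comment> \<open>The operator is multiplication by \<open>l * exp (s f)\<close> plus a term of
    rank one. This inequality is its secular equation with equality relaxed, and it places
    \<open>\<rho>\<close> at or above the top eigenvalue. Cleared of denominators, it is the affine
    inequality times \<open>\<rho>\<close>.\<close>
  show "(1 - l) * (m * (exp s / (\<rho> - l * exp s)) + (1 - m) * (1 / (\<rho> - l))) \<le> 1"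
  proof (cases "\<rho> < exp s")
    case True
    have "(1 - l) * (exp s - 1) * m \<le> \<rho> + l * exp s / \<rho> - l * exp s - 1"
      using Leon_Perron_affine[OF l s m(1)] True unfolding \<rho>_def by simp
    then have "\<rho> * ((1 - l) * (exp s - 1) * m) \<le> \<rho> * (\<rho> + l * exp s / \<rho> - l * exp s - 1)"
      using pos by (intro mult_left_mono) auto
    also have "\<dots> = \<rho> * \<rho> + l * exp s - \<rho> * (l * exp s) - \<rho>"
      using pos by (simp add: field_simps)
    finally have *: "\<rho> * ((1 - l) * (exp s - 1) * m)
      \<le> \<rho> * \<rho> + l * exp s - \<rho> * (l * exp s) - \<rho>" .
    have d: "0 < \<rho> - l * exp s" "0 < \<rho> - l" using pos l by auto
    have "(1 - l) * (m * (exp s / (\<rho> - l * exp s)) + (1 - m) * (1 / (\<rho> - l)))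
      = (1 - l) * (m * exp s * (\<rho> - l) + (1 - m) * (\<rho> - l * exp s))
          / ((\<rho> - l * exp s) * (\<rho> - l))"
      using d by (simp add: field_simps)
    also have "\<dots> \<le> 1"
    proof (subst divide_le_eq_1_pos)
      show "0 < (\<rho> - l * exp s) * (\<rho> - l)" using d by simp
      show "(1 - l) * (m * exp s * (\<rho> - l) + (1 - m) * (\<rho> - l * exp s))
        \<le> (\<rho> - l * exp s) * (\<rho> - l)"
        using * by (simp add: algebra_simps)
    qed
    finally show ?thesis .
  next
    \<comment> \<open>For \<open>exp s \<le> \<rho>\<close> each of the two ratios, multiplied by
      \<open>1 - l\<close>, is already at most 1.\<close>
    case False
    have a: "(1 - l) * (exp s / (\<rho> - l * exp s)) \<le> 1"
      using pos False by (simp add: divide_le_eq_1 algebra_simps)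
    have b: "(1 - l) * (1 / (\<rho> - l)) \<le> 1"
      using pos l False by (simp add: divide_le_eq_1)
    have "(1 - l) * (m * (exp s / (\<rho> - l * exp s)) + (1 - m) * (1 / (\<rho> - l)))
      = m * ((1 - l) * (exp s / (\<rho> - l * exp s))) + (1 - m) * ((1 - l) * (1 / (\<rho> - l)))"
      by (simp add: algebra_simps)
    also have "\<dots> \<le> m * 1 + (1 - m) * 1"
      using a b m by (intro add_mono mult_left_mono) auto
    finally show ?thesis by simp
  qed
qed

lemma exp_le_chord:
  fixes s y :: real
  assumes "0 \<le> y" "y \<le> 1"
  shows "exp (s * y) \<le> 1 - y + y * exp s"
proof -
  have "exp ((1 - y) * 0 + y * s) \<le> (1 - y) * exp 0 + y * exp s"
    using convex_onD[OF convex_on_exp[of 1], of y 0 s] assms by simp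
  then show ?thesis by (simp add: mult.commute)
qed

text \<open>Two convexity steps: \<open>exp (s * y)\<close> lies below its chord \<open>z\<close>,
  and \<open>t / (r - l * t)\<close> is increasing and convex in \<open>t\<close>. Over the common
  denominator the second defect is exactly \<open>y * (1 - y) * (l * r) * (e - 1)\<^sup>2\<close>.
  Integrated over a reward \<open>y = f x\<close>, the right side depends on the mean of
  \<open>f\<close> only.\<close>

lemma ratio_le_chord:
  fixes l r s y :: real
  assumes l: "0 \<le> l" and less: "l * exp s < r" and s: "0 \<le> s" and y: "0 \<le> y" "y \<le> 1"
  shows "l * exp (s * y) < r"
    and "exp (s * y) / (r - l * exp (s * y))
      \<le> y * (exp s / (r - l * exp s)) + (1 - y) * (1 / (r - l))"
proof -
  define e where "e = exp s"
  define z where "z = 1 - y + y * e"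
  have e: "1 \<le> e" unfolding e_def using s by simp
  have ez: "exp (s * y) \<le> z" unfolding z_def e_def using y by (rule exp_le_chord)
  have "0 \<le> y * (e - 1)" "0 \<le> (1 - y) * (e - 1)" using y e by auto
  then have z: "z \<le> e" "1 \<le> z" unfolding z_def by (auto simp: algebra_simps)
  have "l * 1 \<le> l * z" "l * z \<le> l * e" "l * exp (s * y) \<le> l * z"
    using z ez l by (intro mult_left_mono; simp)+
  then have d: "0 < r - l * e" "0 < r - l * z" "0 < r - l" "r - l * z \<le> r - l * exp (s * y)"
    using less unfolding e_def by auto
  then show "l * exp (s * y) < r" by linarith
  have "exp (s * y) / (r - l * exp (s * y)) \<le> z / (r - l * z)"
    using ez d z by (intro frac_le) auto
  also have "\<dots> \<le> y * (e / (r - l * e)) + (1 - y) * (1 / (r - l))"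
  proof -
    have "r = (r - l * e) + l * e" by simp
    then have "0 < r" using d(1) l e by (metis add_pos_nonneg mult_nonneg_nonneg order_trans zero_le_one)
    have "(y * (e / a) + (1 - y) * (1 / b) - z / c) * (a * b * c)
      = y * e * b * c + (1 - y) * a * c - z * a * b"
      if "a \<noteq> 0" "b \<noteq> 0" "c \<noteq> 0" for a b c :: real
      using that by (simp add: field_simps)
    then have "(y * (e / (r - l * e)) + (1 - y) * (1 / (r - l)) - z / (r - l * z))
        * ((r - l * e) * (r - l) * (r - l * z))
      = y * e * (r - l) * (r - l * z) + (1 - y) * (r - l * e) * (r - l * z)
        - z * (r - l * e) * (r - l)"
      using d by simp
    also have "\<dots> = y * (1 - y) * (l * r) * (e - 1)\<^sup>2"
      unfolding z_def by algebra
    also have "\<dots> \<ge> 0" using y l \<open>0 < r\<close> by simp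
    finally have "0 \<le> y * (e / (r - l * e)) + (1 - y) * (1 / (r - l)) - z / (r - l * z)"
      using d by (meson mult_neg_pos mult_pos_pos not_less)
    then show ?thesis by simp
  qed
  finally show "exp (s * y) / (r - l * exp (s * y))
      \<le> y * (exp s / (r - l * exp s)) + (1 - y) * (1 / (r - l))"
    unfolding e_def .
qed

section \<open>Bounded functions and invariant kernels\<close>

text \<open>The bound holds at every point and not just almost everywhere, so such functions are
  integrable under every \<open>P x\<close> and the class is stable under the transition operator
  without any care for null sets.\<close>

definition bounded_fun :: "'a measure \<Rightarrow> ('a \<Rightarrow> real) set" where
  "bounded_fun S = {h \<in> borel_measurable S. \<exists>B. \<forall>x\<in>space S. \<bar>h x\<bar> \<le> B}"

lemma bounded_funI: "h \<in> borel_measurable S \<Longrightarrow> (\<And>x. x \<in> space S \<Longrightarrow> \<bar>h x\<bar> \<le> B) \<Longrightarrow> h \<in> bounded_fun S"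
  by (auto simp: bounded_fun_def)

lemma bounded_fun_measurable [measurable_dest]: "h \<in> bounded_fun S \<Longrightarrow> h \<in> borel_measurable S"
  by (simp add: bounded_fun_def)

lemma bounded_funE:
  assumes "h \<in> bounded_fun S"
  obtains B where "0 \<le> B" "\<And>x. x \<in> space S \<Longrightarrow> \<bar>h x\<bar> \<le> B"
proof -
  from assms obtain B where "\<forall>x\<in>space S. \<bar>h x\<bar> \<le> B" by (auto simp: bounded_fun_def)
  then show ?thesis by (intro that[of "\<bar>B\<bar>"]) force+
qed

lemma bounded_fun_const [simp, intro]: "(\<lambda>x. c) \<in> bounded_fun S"
  by (rule bounded_funI[of _ _ "\<bar>c\<bar>"]) auto

lemma bounded_fun_add [intro]:
  assumes g: "g \<in> bounded_fun S" and h: "h \<in> bounded_fun S"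
  shows "(\<lambda>x. g x + h x) \<in> bounded_fun S"
proof -
  obtain B C where "\<And>x. x \<in> space S \<Longrightarrow> \<bar>g x\<bar> \<le> B" "\<And>x. x \<in> space S \<Longrightarrow> \<bar>h x\<bar> \<le> C"
    using g h by (metis bounded_funE)
  with g h show ?thesis
    by (intro bounded_funI[of _ _ "B + C"]) (auto simp: bounded_fun_measurable intro: order_trans[OF abs_triangle_ineq] add_mono)
qed

lemma bounded_fun_mult [intro]:
  assumes g: "g \<in> bounded_fun S" and h: "h \<in> bounded_fun S"
  shows "(\<lambda>x. g x * h x) \<in> bounded_fun S"
proof -
  obtain B C where "0 \<le> B" "\<And>x. x \<in> space S \<Longrightarrow> \<bar>g x\<bar> \<le> B" "\<And>x. x \<in> space S \<Longrightarrow> \<bar>h x\<bar> \<le> C"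
    using g h by (metis bounded_funE)
  with g h show ?thesis
    by (intro bounded_funI[of _ _ "B * C"]) (auto simp: bounded_fun_measurable abs_mult intro: mult_mono)
qed

lemma bounded_fun_diff [intro]:
  "g \<in> bounded_fun S \<Longrightarrow> h \<in> bounded_fun S \<Longrightarrow> (\<lambda>x. g x - h x) \<in> bounded_fun S"
  using bounded_fun_add[of g S "\<lambda>x. (-1) * h x"] bounded_fun_mult[of "\<lambda>x. -1" S h] by simp

lemma bounded_fun_sum [intro]:
  "(\<And>i. i \<in> I \<Longrightarrow> g i \<in> bounded_fun S) \<Longrightarrow> (\<lambda>x. \<Sum>i\<in>I. g i x) \<in> bounded_fun S"
  by (induction I rule: infinite_finite_induct) auto

lemma bounded_fun_prod [intro]:
  "(\<And>i. i \<in> I \<Longrightarrow> g i \<in> bounded_fun S) \<Longrightarrow> (\<lambda>x. \<Prod>i\<in>I. g i x) \<in> bounded_fun S"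
  by (induction I rule: infinite_finite_induct) auto

lemma bounded_fun_power2 [intro]: "g \<in> bounded_fun S \<Longrightarrow> (\<lambda>x. (g x)\<^sup>2) \<in> bounded_fun S"
  by (auto simp: power2_eq_square)

text \<open>Negative arguments are covered because \<open>sqrt\<close> is extended to an odd
  function.\<close>

lemma abs_sqrt_le: "\<bar>y\<bar> \<le> B \<Longrightarrow> \<bar>sqrt y\<bar> \<le> sqrt B"
  by (cases "0 \<le> y") (auto simp: abs_if real_sqrt_minus[symmetric] simp del: real_sqrt_minus)

lemma bounded_fun_sqrt:
  assumes g: "g \<in> bounded_fun S"
  shows "(\<lambda>x. sqrt (g x)) \<in> bounded_fun S"
proof -
  obtain B where "\<And>x. x \<in> space S \<Longrightarrow> \<bar>g x\<bar> \<le> B" using g by (metis bounded_funE)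
  with g show ?thesis
    by (intro bounded_funI[of _ _ "sqrt B"])
       (auto simp: bounded_fun_measurable abs_sqrt_le)
qed

lemma bounded_fun_compose:
  assumes h: "h \<in> bounded_fun S" and X: "X \<in> N \<rightarrow>\<^sub>M S"
  shows "(\<lambda>\<omega>. h (X \<omega>)) \<in> bounded_fun N"
proof -
  obtain B where "\<And>x. x \<in> space S \<Longrightarrow> \<bar>h x\<bar> \<le> B" using h by (metis bounded_funE)
  then show ?thesis
    using measurable_space[OF X] measurable_compose[OF X bounded_fun_measurable[OF h]]
    by (intro bounded_funI[of _ _ B]) auto
qed

lemma bounded_fun_integrable:
  assumes "finite_measure N" "sets N = sets S" "h \<in> bounded_fun S"
  shows "integrable N h"
proof -
  interpret finite_measure N by fact
  obtain B where "\<And>x. x \<in> space S \<Longrightarrow> \<bar>h x\<bar> \<le> B" using assms by (metis bounded_funE)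
  then show ?thesis
    using assms sets_eq_imp_space_eq[OF assms(2)]
    by (intro integrable_const_bound[of _ B])
       (auto simp: bounded_fun_measurable cong: measurable_cong_sets)
qed

text \<open>The supremum may be minus infinity, so \<open>real_of_ereal\<close> is faithful only
  after the truncation at 0.\<close>

lemma right_spectral_gap_real:
  assumes "has_right_spectral_gap \<pi> P lr"
  shows "max lr 0 = ereal (real_of_ereal (max lr 0))"
    and "0 \<le> real_of_ereal (max lr 0)" and "real_of_ereal (max lr 0) < 1"
proof -
  have "lr < 1" using assms unfolding has_right_spectral_gap_def by blast
  then show "max lr 0 = ereal (real_of_ereal (max lr 0))"
    "0 \<le> real_of_ereal (max lr 0)" "real_of_ereal (max lr 0) < 1"
    by (cases lr; simp add: max_def)+
qed

locale invariant_kernel = prob_space \<pi> for \<pi> :: "'a measure" +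
  fixes S :: "'a measure" and P :: "'a \<Rightarrow> 'a measure"
  assumes kernel [measurable]: "P \<in> S \<rightarrow>\<^sub>M prob_algebra S"
    and sets_pi [measurable_cong, simp]: "sets \<pi> = sets S"
    and invariant: "\<pi> \<bind> P = \<pi>"
begin

lemma space_pi [simp]: "space \<pi> = space S"
  by (rule sets_eq_imp_space_eq) simp

lemma prob_space_S: "prob (space S) = 1"
  using prob_space by simp

lemma kernel_subprob [measurable]: "P \<in> S \<rightarrow>\<^sub>M subprob_algebra S"
  by (rule measurable_prob_algebraD) measurable

lemma kernel_pi: "P \<in> \<pi> \<rightarrow>\<^sub>M subprob_algebra S"
  by measurable

lemma prob_space_kernel: "x \<in> space S \<Longrightarrow> prob_space (P x)"
  and sets_kernel_eq: "x \<in> space S \<Longrightarrow> sets (P x) = sets S"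
  using measurable_space[OF kernel] by (auto simp: space_prob_algebra)

lemma space_kernel_eq: "x \<in> space S \<Longrightarrow> space (P x) = space S"
  using sets_kernel_eq sets_eq_imp_space_eq by blast

lemma nonempty: "space S \<noteq> {}"
  using not_empty by simp

lemma integrable_kernel: "x \<in> space S \<Longrightarrow> h \<in> bounded_fun S \<Longrightarrow> integrable (P x) h"
  by (rule bounded_fun_integrable[OF prob_space.finite_measure[OF prob_space_kernel] sets_kernel_eq])

lemma integrable_pi: "h \<in> bounded_fun S \<Longrightarrow> integrable \<pi> h"
  by (intro bounded_fun_integrable) (auto simp: finite_measure_axioms)

lemma transition_op_measurable [measurable]:
  "h \<in> borel_measurable S \<Longrightarrow> transition_op P h \<in> borel_measurable S"
  unfolding transition_op_def
  by (rule measurable_compose[OF kernel_subprob integral_measurable_subprob_algebra])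

lemma transition_op_bounded:
  assumes h: "h \<in> bounded_fun S"
  shows "transition_op P h \<in> bounded_fun S"
proof -
  obtain B where B: "0 \<le> B" "\<And>x. x \<in> space S \<Longrightarrow> \<bar>h x\<bar> \<le> B" using h by (metis bounded_funE)
  show ?thesis
  proof (rule bounded_funI)
    show "transition_op P h \<in> borel_measurable S" using h by measurable
    fix x assume x: "x \<in> space S"
    interpret Px: prob_space "P x" using x by (rule prob_space_kernel)
    have "\<bar>transition_op P h x\<bar> \<le> (\<integral>y. \<bar>h y\<bar> \<partial>P x)"
      unfolding transition_op_def using integral_abs_bound by blast
    also have "\<dots> \<le> B"
      using integrable_kernel[OF x h] B space_kernel_eq[OF x]
      by (intro Px.integral_le_const) auto
    finally show "\<bar>transition_op P h x\<bar> \<le> B" .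
  qed
qed

lemma transition_op_const: "x \<in> space S \<Longrightarrow> transition_op P (\<lambda>_. c) x = c"
  unfolding transition_op_def by (simp add: prob_space.prob_space[OF prob_space_kernel])

lemma transition_op_mono:
  assumes "g \<in> bounded_fun S" "h \<in> bounded_fun S" "x \<in> space S"
    and "\<And>y. y \<in> space S \<Longrightarrow> g y \<le> h y"
  shows "transition_op P g x \<le> transition_op P h x"
  unfolding transition_op_def using assms
  by (intro integral_mono integrable_kernel) (auto simp: space_kernel_eq)

lemma transition_op_nonneg:
  assumes "x \<in> space S" "\<And>y. y \<in> space S \<Longrightarrow> 0 \<le> h y"
  shows "0 \<le> transition_op P h x"
  unfolding transition_op_def using assms
  by (intro integral_nonneg_AE AE_I2) (auto simp: space_kernel_eq)

lemma transition_op_diff: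
  assumes "g \<in> bounded_fun S" "h \<in> bounded_fun S" "x \<in> space S"
  shows "transition_op P (\<lambda>y. g y - h y) x = transition_op P g x - transition_op P h x"
  unfolding transition_op_def using assms
  by (intro Bochner_Integration.integral_diff integrable_kernel)

lemma transition_op_cmult:
  "transition_op P (\<lambda>y. c * h y) x = c * transition_op P h x"
  unfolding transition_op_def by simp

lemma transition_op_sum:
  assumes "\<And>i. i \<in> I \<Longrightarrow> g i \<in> bounded_fun S" "x \<in> space S"
  shows "transition_op P (\<lambda>y. \<Sum>i\<in>I. g i y) x = (\<Sum>i\<in>I. transition_op P (g i) x)"
  unfolding transition_op_def using assms
  by (intro Bochner_Integration.integral_sum integrable_kernel)

lemma integral_transition_op:
  assumes h: "h \<in> bounded_fun S"
  shows "(\<integral>x. transition_op P h x \<partial>\<pi>) = (\<integral>x. h x \<partial>\<pi>)"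
proof -
  obtain B where B: "0 \<le> B" "\<And>x. x \<in> space S \<Longrightarrow> \<bar>h x\<bar> \<le> B" using h by (metis bounded_funE)
  have "(\<integral>x. h x \<partial>(\<pi> \<bind> P)) = (\<integral>x. transition_op P h x \<partial>\<pi>)"
    unfolding transition_op_def
  proof (rule integral_bind[where K=S and B=B and B'=1])
    show "AE x in \<pi>. emeasure (P x) (space (P x)) \<le> ennreal 1"
      by (intro AE_I2) (simp add: prob_space.emeasure_space_1[OF prob_space_kernel])
  qed (use B h in \<open>auto simp: bounded_fun_measurable finite_measure_axioms kernel_pi\<close>)
  then show ?thesis by (simp add: invariant)
qed

section \<open>The spectral gap as a bound on a quadratic form\<close>

lemma L2_integrable:
  assumes "h \<in> L2 \<pi>"
  shows "integrable \<pi> h"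
proof -
  have "h \<in> borel_measurable \<pi> \<and> integrable \<pi> (\<lambda>x. (h x)\<^sup>2)"
    using assms unfolding L2_def by (rule CollectD)
  then show ?thesis using square_integrable_imp_integrable[of h] by blast
qed

lemma bounded_fun_L2: "h \<in> bounded_fun S \<Longrightarrow> h \<in> L2 \<pi>"
  using integrable_pi[OF bounded_fun_power2] bounded_fun_measurable
  by (simp add: L2_def cong: measurable_cong_sets)

text \<open>The adjoint of a positive kernel applied to a nonnegative bounded \<open>g\<close> is the density of
  \<open>(g \<pi>) P\<close> with respect to \<open>\<pi>\<close>.\<close>
lemma adjoint_exists_nonneg:
  assumes g: "g \<in> bounded_fun S" and nn: "\<And>x. x \<in> space S \<Longrightarrow> 0 \<le> g x"
  shows "\<exists>k\<in>L2 \<pi>. \<forall>h\<in>L2 \<pi>. integrable \<pi> (\<lambda>x. transition_op P h x * g x) \<and>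
    L2_inner \<pi> (transition_op P h) g = L2_inner \<pi> h k"
proof -
  note [measurable] = bounded_fun_measurable[OF g] kernel_pi
  obtain C where C: "0 \<le> C" "\<And>x. x \<in> space S \<Longrightarrow> \<bar>g x\<bar> \<le> C" using g by (metis bounded_funE)
  define D where "D = density \<pi> (\<lambda>x. ennreal (g x))"
  define \<nu> where "\<nu> = D \<bind> P"
  have D [measurable]: "P \<in> D \<rightarrow>\<^sub>M subprob_algebra S" unfolding D_def by measurable
  have sD [simp]: "space D = space S" "sets D = sets S" by (simp_all add: D_def)
  have sets_nu [simp, measurable_cong]: "sets \<nu> = sets S"
    unfolding \<nu>_def by (rule sets_bind) (auto simp: sets_kernel_eq nonempty)
  have nn_nu: "(\<integral>\<^sup>+x. h x \<partial>\<nu>) = (\<integral>\<^sup>+x. ennreal (g x) * (\<integral>\<^sup>+y. h y \<partial>P x) \<partial>\<pi>)"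
    if [measurable]: "h \<in> borel_measurable S" for h
  proof -
    have m: "(\<lambda>x. \<integral>\<^sup>+y. h y \<partial>P x) \<in> borel_measurable \<pi>"
      by (rule measurable_compose[OF kernel_pi nn_integral_measurable_subprob_algebra]) measurable
    have "(\<integral>\<^sup>+x. h x \<partial>\<nu>) = (\<integral>\<^sup>+x. (\<integral>\<^sup>+y. h y \<partial>P x) \<partial>D)"
      unfolding \<nu>_def by (rule nn_integral_bind[OF that D])
    then show ?thesis unfolding D_def using m by (simp add: nn_integral_density)
  qed
  have nn_pi: "(\<integral>\<^sup>+x. (\<integral>\<^sup>+y. h y \<partial>P x) \<partial>\<pi>) = (\<integral>\<^sup>+x. h x \<partial>\<pi>)"
    if [measurable]: "h \<in> borel_measurable S" for h
    using nn_integral_bind[OF that kernel_pi] by (simp add: invariant)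
  \<comment> \<open>Invariance turns \<open>g \<le> C\<close> into
    \<open>\<nu> \<le> C \<pi>\<close>. This yields both absolute continuity and the bound
    \<open>C\<close> on the density, so the density is square integrable.\<close>
  have nu_le: "(\<integral>\<^sup>+x. h x \<partial>\<nu>) \<le> ennreal C * (\<integral>\<^sup>+x. h x \<partial>\<pi>)"
    if [measurable]: "h \<in> borel_measurable S" for h
  proof -
    have m: "(\<lambda>x. \<integral>\<^sup>+y. h y \<partial>P x) \<in> borel_measurable \<pi>"
      by (rule measurable_compose[OF kernel_pi nn_integral_measurable_subprob_algebra]) measurable
    have "(\<integral>\<^sup>+x. ennreal (g x) * (\<integral>\<^sup>+y. h y \<partial>P x) \<partial>\<pi>)
        \<le> (\<integral>\<^sup>+x. ennreal C * (\<integral>\<^sup>+y. h y \<partial>P x) \<partial>\<pi>)"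
      using C by (intro nn_integral_mono mult_right_mono) (force intro!: ennreal_leI)+
    also have "\<dots> = ennreal C * (\<integral>\<^sup>+x. h x \<partial>\<pi>)"
      using m by (simp add: nn_integral_cmult nn_pi)
    finally show ?thesis by (simp add: nn_nu)
  qed
  have ac: "absolutely_continuous \<pi> \<nu>"
    unfolding absolutely_continuous_def null_sets_def
  proof clarsimp
    fix A assume A: "A \<in> sets S" "emeasure \<pi> A = 0"
    then show "emeasure \<nu> A = 0" using nu_le[of "indicator A"] by simp
  qed
  define r where "r = RN_deriv \<pi> \<nu>"
  have r [measurable]: "r \<in> borel_measurable S" unfolding r_def
    using borel_measurable_RN_deriv[of \<pi> \<nu>] by (simp cong: measurable_cong_sets)
  have nu_r: "(\<integral>\<^sup>+x. h x \<partial>\<nu>) = (\<integral>\<^sup>+x. r x * h x \<partial>\<pi>)"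
    if [measurable]: "h \<in> borel_measurable S" for h
    unfolding r_def by (rule RN_deriv_nn_integral[OF ac]) simp_all
  have r_le: "AE x in \<pi>. r x \<le> ennreal C"
  proof (rule ccontr)
    assume neg: "\<not> (AE x in \<pi>. r x \<le> ennreal C)"
    let ?B = "{x \<in> space S. ennreal C < r x}"
    have "(\<integral>\<^sup>+x. ennreal C * indicator ?B x \<partial>\<pi>) < (\<integral>\<^sup>+x. r x * indicator ?B x \<partial>\<pi>)"
    proof (rule nn_integral_less)
      have "(\<integral>\<^sup>+x. ennreal C * indicator ?B x \<partial>\<pi>) = ennreal C * emeasure \<pi> ?B"
        by (simp add: nn_integral_cmult)
      also have "\<dots> \<noteq> \<infinity>" by (simp add: ennreal_mult_eq_top_iff)
      finally show "(\<integral>\<^sup>+x. ennreal C * indicator ?B x \<partial>\<pi>) \<noteq> \<infinity>" .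
      show "\<not> (AE x in \<pi>. r x * indicator ?B x \<le> ennreal C * indicator ?B x)"
      proof
        assume "AE x in \<pi>. r x * indicator ?B x \<le> ennreal C * indicator ?B x"
        then have "AE x in \<pi>. r x \<le> ennreal C"
          using AE_space
        proof eventually_elim
          case (elim x)
          show ?case
          proof (rule ccontr)
            assume "\<not> r x \<le> ennreal C"
            then have "x \<in> ?B" using elim(2) by simp
            with elim(1) \<open>\<not> r x \<le> ennreal C\<close> show False by simp
          qed
        qed
        with neg show False by simp
      qed
      show "AE x in \<pi>. ennreal C * indicator ?B x \<le> r x * indicator ?B x"
        by (intro AE_I2) (auto split: split_indicator)
    qed measurable
    moreover have "(\<integral>\<^sup>+x. r x * indicator ?B x \<partial>\<pi>) \<le> ennreal C * (\<integral>\<^sup>+x. indicator ?B x \<partial>\<pi>)"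
      using nu_le[of "indicator ?B"] nu_r[of "indicator ?B"] by simp
    ultimately show False by (simp add: nn_integral_cmult)
  qed
  define k where "k = (\<lambda>x. enn2real (r x))"
  have k [measurable]: "k \<in> borel_measurable S" unfolding k_def by measurable
  have rk: "AE x in \<pi>. r x = ennreal (k x)" and k_le: "AE x in \<pi>. \<bar>k x\<bar> \<le> C"
  proof -
    show "AE x in \<pi>. r x = ennreal (k x)" using r_le
      by eventually_elim (auto simp: k_def ennreal_enn2real_if top_unique)
    show "AE x in \<pi>. \<bar>k x\<bar> \<le> C" using r_le
      by eventually_elim (use C in \<open>auto simp: k_def intro: enn2real_leI\<close>)
  qed
  have kL2: "k \<in> L2 \<pi>"
    unfolding L2_def
  proof safe
    show "integrable \<pi> (\<lambda>x. (k x)\<^sup>2)"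
      by (rule integrable_const_bound[of _ "C\<^sup>2"])
         (use k_le in \<open>eventually_elim, use C in \<open>auto simp: power2_le_iff_abs_le\<close>\<close>, measurable)
  qed measurable
  \<comment> \<open>For nonnegative \<open>h\<close> the duality is an identity of nonnegative
    integrals. It transfers to \<open>transition_op\<close> because the integral of \<open>h\<close>
    under \<open>P x\<close> is finite for almost every \<open>x\<close>.\<close>
  have pos: "integrable \<pi> (\<lambda>x. transition_op P h x * g x)
      \<and> (\<integral>x. transition_op P h x * g x \<partial>\<pi>) = (\<integral>x. h x * k x \<partial>\<pi>)
      \<and> (AE x in \<pi>. integrable (P x) h)"
    if h [measurable]: "h \<in> borel_measurable S" and h0: "\<And>x. 0 \<le> h x" and hi: "integrable \<pi> h" for h
  proof -
    have m [measurable]: "(\<lambda>x. \<integral>\<^sup>+y. ennreal (h y) \<partial>P x) \<in> borel_measurable S"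
      by (rule measurable_compose[OF kernel_subprob nn_integral_measurable_subprob_algebra]) measurable
    have fin: "(\<integral>\<^sup>+x. ennreal (h x) \<partial>\<pi>) < \<infinity>"
      using hi h0 by (simp add: integrable_iff_bounded)
    have ae: "AE x in \<pi>. (\<integral>\<^sup>+y. ennreal (h y) \<partial>P x) \<noteq> \<infinity>"
      using fin nn_pi[of "\<lambda>x. ennreal (h x)"] by (intro nn_integral_PInf_AE) (auto simp: less_top)
    have Ph: "transition_op P h x = enn2real (\<integral>\<^sup>+y. ennreal (h y) \<partial>P x)" if "x \<in> space S" for x
      unfolding transition_op_def using h0 sets_kernel_eq[OF that]
      by (intro integral_eq_nn_integral) (auto cong: measurable_cong_sets)
    have ae2: "AE x in \<pi>. ennreal (transition_op P h x * g x)
       = ennreal (g x) * (\<integral>\<^sup>+y. ennreal (h y) \<partial>P x)"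
      using ae AE_space
      by eventually_elim (use Ph nn in \<open>auto simp: ennreal_mult'' less_top mult.commute\<close>)
    have eq: "(\<integral>\<^sup>+x. ennreal (transition_op P h x * g x) \<partial>\<pi>) = (\<integral>\<^sup>+x. ennreal (h x * k x) \<partial>\<pi>)"
    proof -
      have "(\<integral>\<^sup>+x. ennreal (transition_op P h x * g x) \<partial>\<pi>)
         = (\<integral>\<^sup>+x. ennreal (g x) * (\<integral>\<^sup>+y. ennreal (h y) \<partial>P x) \<partial>\<pi>)"
        by (rule nn_integral_cong_AE[OF ae2])
      also have "\<dots> = (\<integral>\<^sup>+x. r x * ennreal (h x) \<partial>\<pi>)"
        using nn_nu[of "\<lambda>x. ennreal (h x)"] nu_r[of "\<lambda>x. ennreal (h x)"] by simp
      also have "\<dots> = (\<integral>\<^sup>+x. ennreal (h x * k x) \<partial>\<pi>)"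
        by (rule nn_integral_cong_AE) (use rk in \<open>eventually_elim,
            auto simp: h0 ennreal_mult' mult.commute\<close>)
      finally show ?thesis .
    qed
    have nnT: "AE x in \<pi>. 0 \<le> transition_op P h x * g x"
      using AE_space by eventually_elim (use Ph nn in auto)
    have "(\<integral>\<^sup>+x. r x * ennreal (h x) \<partial>\<pi>) \<le> ennreal C * (\<integral>\<^sup>+x. ennreal (h x) \<partial>\<pi>)"
      using nu_le[of "\<lambda>x. ennreal (h x)"] nu_r[of "\<lambda>x. ennreal (h x)"] by simp
    also have "\<dots> < \<infinity>" using fin by (simp add: ennreal_mult_less_top)
    finally have "(\<integral>\<^sup>+x. ennreal (g x) * (\<integral>\<^sup>+y. ennreal (h y) \<partial>P x) \<partial>\<pi>) < \<infinity>"
      using nn_nu[of "\<lambda>x. ennreal (h x)"] nu_r[of "\<lambda>x. ennreal (h x)"] by simp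
    then have fin2: "(\<integral>\<^sup>+x. ennreal (transition_op P h x * g x) \<partial>\<pi>) < \<infinity>"
      using nn_integral_cong_AE[OF ae2] by simp
    have i: "integrable \<pi> (\<lambda>x. transition_op P h x * g x)"
      by (rule integrableI_nonneg[OF _ nnT fin2]) measurable
    have "(\<integral>x. transition_op P h x * g x \<partial>\<pi>) = (\<integral>x. h x * k x \<partial>\<pi>)"
      using eq nnT h0 by (subst (1 2) integral_eq_nn_integral) (auto simp: k_def)
    moreover have "AE x in \<pi>. integrable (P x) h"
      using ae AE_space
      by eventually_elim (use h0 sets_kernel_eq in
          \<open>auto simp: integrable_iff_bounded less_top cong: measurable_cong_sets\<close>)
    ultimately show ?thesis using i by simp
  qed
  show ?thesis
  proof (intro bexI[OF _ kL2] ballI)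
    fix h assume hL2: "h \<in> L2 \<pi>"
    then have [measurable]: "h \<in> borel_measurable S" by (auto simp: L2_def)
    have hi: "integrable \<pi> h" using hL2 by (rule L2_integrable)
    define hp where "hp = (\<lambda>x. max (h x) 0)"
    define hm where "hm = (\<lambda>x. max (- h x) 0)"
    have hpm: "h = (\<lambda>x. hp x - hm x)" by (auto simp: hp_def hm_def)
    have [measurable]: "hp \<in> borel_measurable S" "hm \<in> borel_measurable S"
      unfolding hp_def hm_def by measurable
    have ii: "integrable \<pi> hp" "integrable \<pi> hm"
      unfolding hp_def hm_def using hi by auto
    have p: "integrable \<pi> (\<lambda>x. transition_op P hp x * g x)"
        "(\<integral>x. transition_op P hp x * g x \<partial>\<pi>) = (\<integral>x. hp x * k x \<partial>\<pi>)"
        "AE x in \<pi>. integrable (P x) hp"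
      using pos[OF _ _ ii(1)] by (auto simp: hp_def)
    have m: "integrable \<pi> (\<lambda>x. transition_op P hm x * g x)"
        "(\<integral>x. transition_op P hm x * g x \<partial>\<pi>) = (\<integral>x. hm x * k x \<partial>\<pi>)"
        "AE x in \<pi>. integrable (P x) hm"
      using pos[OF _ _ ii(2)] by (auto simp: hm_def)
    \<comment> \<open>The Bochner integral under \<open>P x\<close> splits only where
      \<open>hp\<close> and \<open>hm\<close> are both integrable, which fails at most on a null
      set.\<close>
    have ae: "AE x in \<pi>. transition_op P h x * g x = transition_op P hp x * g x - transition_op P hm x * g x"
      using p(3) m(3) by eventually_elim (simp add: transition_op_def hpm left_diff_distrib)
    have ik: "integrable \<pi> (\<lambda>x. q x * k x)" if "integrable \<pi> q" for q
    proof (rule Bochner_Integration.integrable_bound[where f="\<lambda>x. C * q x"])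
      show "AE x in \<pi>. norm (q x * k x) \<le> norm (C * q x)" using k_le
        by eventually_elim
           (use C in \<open>auto simp: abs_mult mult.commute[of "\<bar>q _\<bar>"] intro: mult_right_mono\<close>)
    qed (use that in auto)
    have ig: "integrable \<pi> (\<lambda>x. transition_op P hp x * g x - transition_op P hm x * g x)"
      using p(1) m(1) by (rule Bochner_Integration.integrable_diff)
    have "integrable \<pi> (\<lambda>x. transition_op P h x * g x)"
      by (rule integrable_cong_AE_imp[OF ig]) (use ae in auto)
    moreover have "(\<integral>x. transition_op P h x * g x \<partial>\<pi>)
        = (\<integral>x. transition_op P hp x * g x - transition_op P hm x * g x \<partial>\<pi>)"
      by (rule integral_cong_AE) (use ae in auto)
    moreover have "\<dots> = (\<integral>x. hp x * k x \<partial>\<pi>) - (\<integral>x. hm x * k x \<partial>\<pi>)"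
      using Bochner_Integration.integral_diff[OF p(1) m(1)] p(2) m(2) by simp
    moreover have "\<dots> = (\<integral>x. h x * k x \<partial>\<pi>)"
      using ik[OF ii(1)] ik[OF ii(2)] by (simp add: hpm left_diff_distrib)
    ultimately show "integrable \<pi> (\<lambda>x. transition_op P h x * g x) \<and>
        L2_inner \<pi> (transition_op P h) g = L2_inner \<pi> h k"
      by (simp add: L2_inner_def)
  qed
qed

text \<open>\<open>L2_adjoint\<close> is a Hilbert choice, so its defining property becomes
  available only once a witness exists. For signed \<open>g\<close>, the functions
  \<open>g + C\<close> and \<open>C\<close> are both nonnegative, and the difference of their
  witnesses serves \<open>g\<close>.\<close>

lemma adjoint_exists:
  assumes g: "g \<in> bounded_fun S"
  shows "\<exists>k. k \<in> L2 \<pi> \<and> (\<forall>h\<in>L2 \<pi>. L2_inner \<pi> (transition_op P h) g = L2_inner \<pi> h k)"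
proof -
  obtain C where C: "0 \<le> C" "\<And>x. x \<in> space S \<Longrightarrow> \<bar>g x\<bar> \<le> C" using g by (metis bounded_funE)
  have gC: "(\<lambda>x. g x + C) \<in> bounded_fun S" using g by auto
  have nn: "0 \<le> g x + C" if "x \<in> space S" for x using C(2)[OF that] by linarith
  obtain k where k: "k \<in> L2 \<pi>" and kk: "\<And>h. h \<in> L2 \<pi> \<Longrightarrow> integrable \<pi> (\<lambda>x. transition_op P h x * (g x + C))"
    "\<And>h. h \<in> L2 \<pi> \<Longrightarrow> (\<integral>x. transition_op P h x * (g x + C) \<partial>\<pi>) = (\<integral>x. h x * k x \<partial>\<pi>)"
    using adjoint_exists_nonneg[OF gC nn] unfolding L2_inner_def by blast
  obtain k' where k': "k' \<in> L2 \<pi>" and kk': "\<And>h. h \<in> L2 \<pi> \<Longrightarrow> integrable \<pi> (\<lambda>x. transition_op P h x * C)"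
    "\<And>h. h \<in> L2 \<pi> \<Longrightarrow> (\<integral>x. transition_op P h x * C \<partial>\<pi>) = (\<integral>x. h x * k' x \<partial>\<pi>)"
    using adjoint_exists_nonneg[OF bounded_fun_const, of C] C(1) unfolding L2_inner_def by blast
  have L2D: "q \<in> borel_measurable \<pi>" "integrable \<pi> (\<lambda>x. (q x)\<^sup>2)" if "q \<in> L2 \<pi>" for q
    using that unfolding L2_def by (auto dest: CollectD)
  have prod: "integrable \<pi> (\<lambda>x. p x * q x)" if p: "p \<in> L2 \<pi>" and q: "q \<in> L2 \<pi>" for p q
  proof (rule Bochner_Integration.integrable_bound)
    show "integrable \<pi> (\<lambda>x. (p x)\<^sup>2 + (q x)\<^sup>2)" using L2D[OF p] L2D[OF q] by simp
    show "(\<lambda>x. p x * q x) \<in> borel_measurable \<pi>" using L2D[OF p] L2D[OF q] by simp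
    have "\<bar>a * b\<bar> \<le> a\<^sup>2 + b\<^sup>2" for a b :: real
    proof -
      have "2 * (\<bar>a\<bar> * \<bar>b\<bar>) \<le> a\<^sup>2 + b\<^sup>2"
        using sum_squares_bound[of "\<bar>a\<bar>" "\<bar>b\<bar>"] by (simp add: mult.assoc)
      moreover have "0 \<le> \<bar>a\<bar> * \<bar>b\<bar>" by simp
      ultimately show ?thesis unfolding abs_mult by linarith
    qed
    then show "AE x in \<pi>. norm (p x * q x) \<le> norm ((p x)\<^sup>2 + (q x)\<^sup>2)" by simp
  qed
  have mem: "(\<lambda>x. k x - k' x) \<in> L2 \<pi>"
  proof -
    have "integrable \<pi> (\<lambda>x. (k x)\<^sup>2 + (k' x)\<^sup>2 - 2 * (k x * k' x))"
      using L2D[OF k] L2D[OF k'] prod[OF k k'] by simp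
    then have "integrable \<pi> (\<lambda>x. (k x - k' x)\<^sup>2)"
      by (simp add: power2_diff algebra_simps)
    then show ?thesis using L2D[OF k] L2D[OF k'] unfolding L2_def by simp
  qed
  have "L2_inner \<pi> (transition_op P h) g = L2_inner \<pi> h (\<lambda>x. k x - k' x)" if h: "h \<in> L2 \<pi>" for h
  proof -
    have "(\<integral>x. transition_op P h x * g x \<partial>\<pi>)
        = (\<integral>x. transition_op P h x * (g x + C) - transition_op P h x * C \<partial>\<pi>)"
      by (simp add: algebra_simps)
    also have "\<dots> = (\<integral>x. h x * k x \<partial>\<pi>) - (\<integral>x. h x * k' x \<partial>\<pi>)"
      using Bochner_Integration.integral_diff[OF kk(1)[OF h] kk'(1)[OF h]] kk(2)[OF h] kk'(2)[OF h]
      by simp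
    also have "\<dots> = (\<integral>x. h x * (k x - k' x) \<partial>\<pi>)"
      using Bochner_Integration.integral_diff[OF prod[OF h k] prod[OF h k']]
      by (simp add: right_diff_distrib)
    finally show ?thesis unfolding L2_inner_def .
  qed
  with mem show ?thesis by blast
qed

text \<open>A real quadratic form sees only the symmetric part: testing the adjoint of
  \<open>h\<close> against \<open>h\<close> itself returns the form of the transition
  operator.\<close>

lemma L2_inner_additive_reversibilization:
  assumes h: "h \<in> bounded_fun S"
  shows "L2_inner \<pi> (additive_reversibilization \<pi> P h) h = L2_inner \<pi> (transition_op P h) h"
proof -
  define k where "k = L2_adjoint \<pi> (transition_op P) h"
  have k: "k \<in> L2 \<pi>" "\<forall>q\<in>L2 \<pi>. L2_inner \<pi> (transition_op P q) h = L2_inner \<pi> q k"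
    using someI_ex[OF adjoint_exists[OF h]] unfolding k_def L2_adjoint_def by auto
  have eq: "(\<integral>x. transition_op P h x * h x \<partial>\<pi>) = (\<integral>x. k x * h x \<partial>\<pi>)"
    using k(2) bounded_fun_L2[OF h] unfolding L2_inner_def by (simp add: mult.commute)
  have i1: "integrable \<pi> (\<lambda>x. transition_op P h x * h x)"
    by (intro integrable_pi bounded_fun_mult transition_op_bounded h)
  obtain C where C: "0 \<le> C" "\<And>x. x \<in> space S \<Longrightarrow> \<bar>h x\<bar> \<le> C" using h by (metis bounded_funE)
  have i2: "integrable \<pi> (\<lambda>x. k x * h x)"
  proof (rule Bochner_Integration.integrable_bound)
    show "integrable \<pi> (\<lambda>x. C * k x)" using L2_integrable[OF k(1)] by simp
    show "(\<lambda>x. k x * h x) \<in> borel_measurable \<pi>"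
      using borel_measurable_integrable[OF L2_integrable[OF k(1)]]
        borel_measurable_integrable[OF integrable_pi[OF h]] by simp
    show "AE x in \<pi>. norm (k x * h x) \<le> norm (C * k x)"
      using C by (intro AE_I2) (auto simp: abs_mult mult.commute[of C] intro: mult_left_mono)
  qed
  have "L2_inner \<pi> (additive_reversibilization \<pi> P h) h
      = (\<integral>x. (transition_op P h x * h x + k x * h x) / 2 \<partial>\<pi>)"
    unfolding L2_inner_def additive_reversibilization_def k_def by (simp add: distrib_right)
  also have "\<dots> = L2_inner \<pi> (transition_op P h) h"
    using Bochner_Integration.integral_add[OF i1 i2] eq unfolding L2_inner_def by simp
  finally show ?thesis .
qed

text \<open>Scaled to norm 1, a centered \<open>h\<close> competes in the supremum that defines the
  gap, and both sides are homogeneous of degree 2.\<close>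

lemma spectral_gap_centered:
  assumes gap: "has_right_spectral_gap \<pi> P lr"
    and h: "h \<in> bounded_fun S" and h0: "(\<integral>x. h x \<partial>\<pi>) = 0"
  shows "(\<integral>x. transition_op P h x * h x \<partial>\<pi>) \<le> real_of_ereal (max lr 0) * (\<integral>x. (h x)\<^sup>2 \<partial>\<pi>)"
proof -
  define l where "l = real_of_ereal (max lr 0)"
  have l: "max lr 0 = ereal l" "0 \<le> l"
    using right_spectral_gap_real[OF gap] unfolding l_def by simp_all
  define q where "q = (\<integral>x. (h x)\<^sup>2 \<partial>\<pi>)"
  have q0: "0 \<le> q" unfolding q_def by simp
  show ?thesis
  \<comment> \<open>A function of norm 0 cannot be normalised, but it vanishes almost everywhere,
    and then both sides are 0.\<close>
  proof (cases "q = 0")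
    case True
    have "AE x in \<pi>. (h x)\<^sup>2 = 0"
      using True integral_nonneg_eq_0_iff_AE[OF integrable_pi[OF bounded_fun_power2[OF h]]]
      unfolding q_def by simp
    then have "AE x in \<pi>. transition_op P h x * h x = 0" by eventually_elim simp
    then have "(\<integral>x. transition_op P h x * h x \<partial>\<pi>) = 0"
      by (rule integral_eq_zero_AE)
    then show ?thesis using True unfolding q_def by simp
  next
    case False
    then have q: "0 < q" using q0 by simp
    define c where "c = 1 / sqrt q"
    have c2: "c * c * q = 1" unfolding c_def using q by simp
    define g where "g = (\<lambda>x. c * h x)"
    have g: "g \<in> bounded_fun S" unfolding g_def using h by auto
    have "(\<integral>x. g x * g x \<partial>\<pi>) = (\<integral>x. (c * c) * (h x)\<^sup>2 \<partial>\<pi>)"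
      unfolding g_def by (rule Bochner_Integration.integral_cong) (simp_all add: power2_eq_square)
    also have "\<dots> = 1" using c2 unfolding q_def by simp
    finally have norm: "L2_norm \<pi> g = 1" unfolding L2_norm_def L2_inner_def by simp
    have mean: "(\<integral>x. g x \<partial>\<pi>) = 0" unfolding g_def using h0 by simp
    have "ereal (L2_inner \<pi> (additive_reversibilization \<pi> P g) g) \<le> lr"
      using gap bounded_fun_L2[OF g] norm mean unfolding has_right_spectral_gap_def
      by (auto intro!: SUP_upper)
    then have "ereal (L2_inner \<pi> (transition_op P g) g) \<le> ereal l"
      unfolding L2_inner_additive_reversibilization[OF g] l(1)[symmetric] by (simp add: le_max_iff_disj)
    then have "(\<integral>x. transition_op P g x * g x \<partial>\<pi>) \<le> l" unfolding L2_inner_def by simp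
    moreover have "(\<integral>x. transition_op P g x * g x \<partial>\<pi>)
        = (\<integral>x. (c * c) * (transition_op P h x * h x) \<partial>\<pi>)"
      unfolding g_def transition_op_cmult
      by (rule Bochner_Integration.integral_cong) simp_all
    ultimately have "(c * c) * (\<integral>x. transition_op P h x * h x \<partial>\<pi>) \<le> l" by simp
    then have "q * ((c * c) * (\<integral>x. transition_op P h x * h x \<partial>\<pi>)) \<le> q * l"
      using q by (intro mult_left_mono) auto
    moreover have "q * ((c * c) * (\<integral>x. transition_op P h x * h x \<partial>\<pi>))
        = (c * c * q) * (\<integral>x. transition_op P h x * h x \<partial>\<pi>)" by (simp only: ac_simps)
    ultimately have "(\<integral>x. transition_op P h x * h x \<partial>\<pi>) \<le> q * l" by (simp only: c2 mult_1)
    then show ?thesis unfolding q_def l_def by (simp only: mult.commute)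
  qed
qed

text \<open>The right side is the quadratic form of \<open>l I + (1 - l) E_\<pi>\<close>.
  Subtracting the mean \<open>m\<close> from \<open>g\<close> lowers both the form of the transition
  operator and the squared norm by exactly \<open>m\<^sup>2\<close>, since the operator preserves
  constants and means.\<close>

lemma spectral_gap_bound:
  assumes gap: "has_right_spectral_gap \<pi> P lr" and g: "g \<in> bounded_fun S"
  defines "l \<equiv> real_of_ereal (max lr 0)"
  shows "(\<integral>x. transition_op P g x * g x \<partial>\<pi>)
    \<le> l * (\<integral>x. (g x)\<^sup>2 \<partial>\<pi>) + (1 - l) * (\<integral>x. g x \<partial>\<pi>)\<^sup>2"
proof -
  define m where "m = (\<integral>x. g x \<partial>\<pi>)"
  define h where "h = (\<lambda>x. g x - m)"
  have h: "h \<in> bounded_fun S" unfolding h_def using g by auto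
  note [simp] = integrable_pi
  have Tg: "transition_op P g \<in> bounded_fun S" using g by (rule transition_op_bounded)
  have mean: "(\<integral>x. h x \<partial>\<pi>) = 0" unfolding h_def using g by (simp add: m_def prob_space_S)
  have sq: "(\<integral>x. (h x)\<^sup>2 \<partial>\<pi>) = (\<integral>x. (g x)\<^sup>2 \<partial>\<pi>) - m\<^sup>2"
  proof -
    have "(\<integral>x. (h x)\<^sup>2 \<partial>\<pi>) = (\<integral>x. (g x)\<^sup>2 - (2 * m) * g x + m\<^sup>2 \<partial>\<pi>)"
      unfolding h_def by (rule Bochner_Integration.integral_cong) (simp_all add: power2_diff)
    also have "\<dots> = (\<integral>x. (g x)\<^sup>2 \<partial>\<pi>) - (2 * m) * m + m\<^sup>2"
      using g bounded_fun_power2[OF g] by (simp add: m_def prob_space_S)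
    finally show ?thesis by (simp add: power2_eq_square)
  qed
  have "(\<integral>x. transition_op P h x * h x \<partial>\<pi>) = (\<integral>x. transition_op P g x * g x \<partial>\<pi>) - m\<^sup>2"
  proof -
    have "(\<integral>x. transition_op P h x * h x \<partial>\<pi>)
        = (\<integral>x. transition_op P g x * g x - m * transition_op P g x - m * g x + m\<^sup>2 \<partial>\<pi>)"
    proof (rule Bochner_Integration.integral_cong)
      fix x assume "x \<in> space \<pi>"
      then have Th: "transition_op P h x = transition_op P g x - m"
        unfolding h_def using transition_op_diff[OF g bounded_fun_const] transition_op_const by simp
      have hx: "h x = g x - m" by (simp add: h_def)
      show "transition_op P h x * h x
        = transition_op P g x * g x - m * transition_op P g x - m * g x + m\<^sup>2"
        unfolding Th hx by (simp add: algebra_simps power2_eq_square)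
    qed simp
    also have "\<dots> = (\<integral>x. transition_op P g x * g x \<partial>\<pi>) - m * m - m * m + m\<^sup>2"
      using g Tg bounded_fun_mult[OF Tg g] integral_transition_op[OF g]
      by (simp add: m_def prob_space_S)
    finally show ?thesis by (simp add: power2_eq_square)
  qed
  with spectral_gap_centered[OF gap h mean] sq show ?thesis
    unfolding l_def m_def by (simp add: algebra_simps)
qed

section \<open>Power inequality and tilted operators\<close>

text \<open>Berger's power inequality for numerical radii, specialised to positive operators.  The
  Cauchy-Schwarz inequality is applied to the cyclic sum of \<open>\<langle>T (w y\<^sub>k), w y\<^sub>k\<^sub>+\<^sub>1\<rangle>\<close> over
  \<open>k = 0, \<dots>, n - 1\<close>, where \<open>y\<^sub>k = u\<^sub>k / r ^ k\<close>; all terms but the last cancel.\<close>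
lemma power_inequality:
  fixes w :: "'a \<Rightarrow> real" and u :: "nat \<Rightarrow> 'a \<Rightarrow> real"
  assumes w: "w \<in> bounded_fun S" "\<And>x. x \<in> space S \<Longrightarrow> 0 \<le> w x" and r: "0 < r"
    and form: "\<And>v. v \<in> bounded_fun S \<Longrightarrow>
      (\<integral>x. transition_op P (\<lambda>y. w y * v y) x * (w x * v x) \<partial>\<pi>) \<le> r * (\<integral>x. w x * (v x)\<^sup>2 \<partial>\<pi>)"
    and u0: "u 0 = (\<lambda>_. 1)" and u_Suc: "\<And>k. u (Suc k) = transition_op P (\<lambda>y. w y * u k y)"
  shows "(\<integral>x. w x * u n x \<partial>\<pi>) \<le> r ^ n * (\<integral>x. w x \<partial>\<pi>)"
proof (cases n)
  case 0
  then show ?thesis by (simp add: u0)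
next
  case (Suc m)
  note [simp] = integrable_pi
  have u: "u k \<in> bounded_fun S" for k
    by (induction k) (auto simp: u0 u_Suc intro!: transition_op_bounded bounded_fun_mult w(1))
  have u_nn: "0 \<le> u k x" if "x \<in> space S" for k x
    using that by (induction k arbitrary: x) (auto simp: u0 u_Suc w intro!: transition_op_nonneg mult_nonneg_nonneg)
  define y where "y k x = u k x / r ^ k" for k x
  \<comment> \<open>\<open>z k\<close> is the successor of \<open>y k\<close> in the cycle
    \<open>y 0, ..., y m\<close> of length \<open>n = Suc m\<close>. Closing the cycle makes any sum
    over the \<open>z k\<close> equal to the sum over the \<open>y k\<close>.\<close>
  define z where "z k = (if k = m then y 0 else y (Suc k))" for k
  have y: "y k \<in> bounded_fun S" for k
    unfolding y_def[abs_def] using bounded_fun_mult[OF bounded_fun_const[of "1 / r ^ k"] u[of k]]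
    by simp
  have y_nn: "0 \<le> y k x" if "x \<in> space S" for k x
    unfolding y_def using u_nn[OF that] r by simp
  have z: "z k \<in> bounded_fun S" for k unfolding z_def using y by simp
  have cyc: "(\<Sum>k\<le>m. F (z k)) = (\<Sum>k\<le>m. F (y k))" for F :: "('a \<Rightarrow> real) \<Rightarrow> real"
  proof -
    have "(\<Sum>k\<le>m. F (z k)) = (\<Sum>k<m. F (z k)) + F (z m)"
      by (simp add: lessThan_Suc_atMost[symmetric])
    also have "\<dots> = (\<Sum>k<m. F (y (Suc k))) + F (y 0)" by (simp add: z_def)
    also have "\<dots> = (\<Sum>k<Suc m. F (y k))" by (subst sum.lessThan_Suc_shift) simp
    finally show ?thesis by (simp add: lessThan_Suc_atMost)
  qed
  define T where "T v = transition_op P (\<lambda>y. w y * v y)" for v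
  have T: "T v \<in> bounded_fun S" if "v \<in> bounded_fun S" for v
    unfolding T_def by (intro transition_op_bounded bounded_fun_mult w(1) that)
  have Ty: "T (y k) x = r * y (Suc k) x" for k x
  proof -
    have "T (y k) x = transition_op P (\<lambda>t. (1 / r ^ k) * (w t * u k t)) x"
      unfolding T_def y_def by (simp add: ac_simps)
    also have "\<dots> = (1 / r ^ k) * u (Suc k) x" by (simp only: transition_op_cmult u_Suc)
    also have "\<dots> = r * y (Suc k) x" unfolding y_def using r by simp
    finally show ?thesis .
  qed
  \<comment> \<open>The Euclidean norm of the vector of all iterates at \<open>x\<close>.
    Cauchy-Schwarz for these vectors, taken under the kernel, is where positivity enters: it
    survives multiplication by \<open>w\<close> and integration against \<open>P x\<close>.\<close>
  define Y where "Y x = sqrt (\<Sum>k\<le>m. (y k x)\<^sup>2)" for x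
  have Y: "Y \<in> bounded_fun S" unfolding Y_def[abs_def] by (intro bounded_fun_sqrt bounded_fun_sum bounded_fun_power2 y)
  have Y2: "(Y x)\<^sup>2 = (\<Sum>k\<le>m. (y k x)\<^sup>2)" for x unfolding Y_def by (simp add: sum_nonneg)
  have Yz: "Y x = sqrt (\<Sum>k\<le>m. (z k x)\<^sup>2)" for x
    unfolding Y_def using cyc[of "\<lambda>v. (v x)\<^sup>2"] by simp
  have pointwise: "(\<Sum>k\<le>m. T (y k) x * z k x) \<le> T Y x * Y x" if x: "x \<in> space S" for x
  proof -
    have "(\<Sum>k\<le>m. T (y k) x * z k x) = transition_op P (\<lambda>t. \<Sum>k\<le>m. z k x * (w t * y k t)) x"
      unfolding T_def using x w y
      by (subst transition_op_sum) (auto simp: transition_op_cmult mult.commute intro!: bounded_fun_mult)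
    also have "\<dots> \<le> transition_op P (\<lambda>t. Y x * (w t * Y t)) x"
    proof (rule transition_op_mono[OF _ _ x])
      fix t assume t: "t \<in> space S"
      have "(\<Sum>k\<le>m. z k x * y k t) \<le> \<bar>\<Sum>k\<le>m. z k x * y k t\<bar>" by simp
      also have "\<dots> \<le> sqrt ((\<Sum>k\<le>m. (z k x)\<^sup>2) * (\<Sum>k\<le>m. (y k t)\<^sup>2))"
        using Cauchy_Schwarz_ineq_sum[of "\<lambda>k. z k x" "\<lambda>k. y k t" "{..m}"]
        by (intro real_le_rsqrt) simp
      also have "\<dots> = Y x * Y t" unfolding Yz[of x] Y_def[of t] by (simp add: real_sqrt_mult)
      finally have "w t * (\<Sum>k\<le>m. z k x * y k t) \<le> w t * (Y x * Y t)"
        using w(2)[OF t] by (rule mult_left_mono)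
      then show "(\<Sum>k\<le>m. z k x * (w t * y k t)) \<le> Y x * (w t * Y t)"
        by (simp add: sum_distrib_left ac_simps)
    qed (intro bounded_fun_sum bounded_fun_mult bounded_fun_const w y Y)+
    also have "\<dots> = T Y x * Y x" unfolding transition_op_cmult T_def by (simp add: mult.commute)
    finally show ?thesis .
  qed
  define G where "G v = (\<integral>x. w x * (v x)\<^sup>2 \<partial>\<pi>)" for v
  \<comment> \<open>Since \<open>T (y k) = r * y (Suc k)\<close>, each term is a square except at
    \<open>k = m\<close>, where \<open>z m = y 0\<close> is the constant 1 and the wanted integral
    appears.\<close>
  have "(\<integral>x. T (y k) x * (w x * z k x) \<partial>\<pi>)
      = (if k = m then (\<integral>x. w x * u n x \<partial>\<pi>) / r ^ m else r * G (z k))" for k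
  proof (cases "k = m")
    case True
    have "T (y m) x * (w x * z m x) = w x * u n x / r ^ m" for x
      unfolding Ty z_def y_def u0 using r by (simp add: Suc)
    then show ?thesis using True by simp
  next
    case False
    have "T (y k) x * (w x * z k x) = r * (w x * (z k x)\<^sup>2)" for x
      unfolding Ty z_def using False by (simp add: power2_eq_square)
    then show ?thesis using False by (simp only: G_def if_False integral_mult_right_zero)
  qed
  then have "(\<integral>x. w x * u n x \<partial>\<pi>) / r ^ m + r * (\<Sum>k<m. G (z k))
      = (\<Sum>k\<le>m. (\<integral>x. T (y k) x * (w x * z k x) \<partial>\<pi>))"
    by (simp add: lessThan_Suc_atMost[symmetric] sum_distrib_left)
  also have "\<dots> = (\<integral>x. (\<Sum>k\<le>m. T (y k) x * (w x * z k x)) \<partial>\<pi>)"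
    by (intro Bochner_Integration.integral_sum[symmetric] integrable_pi bounded_fun_mult T y z w)
  also have "\<dots> \<le> (\<integral>x. T Y x * (w x * Y x) \<partial>\<pi>)"
  proof (rule integral_mono)
    fix x assume "x \<in> space \<pi>"
    then have x: "x \<in> space S" by simp
    have "(\<Sum>k\<le>m. T (y k) x * (w x * z k x)) = w x * (\<Sum>k\<le>m. T (y k) x * z k x)"
      by (simp add: sum_distrib_left ac_simps)
    also have "\<dots> \<le> w x * (T Y x * Y x)"
      using pointwise[OF x] w(2)[OF x] by (rule mult_left_mono)
    finally show "(\<Sum>k\<le>m. T (y k) x * (w x * z k x)) \<le> T Y x * (w x * Y x)"
      by (simp add: ac_simps)
  qed (intro integrable_pi bounded_fun_sum bounded_fun_mult T y z w Y)+
  \<comment> \<open>The hypothesis on the form is used once, for \<open>Y\<close>. The summands of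
    \<open>r * G Y\<close> with \<open>k < m\<close> cancel against the left side, and
    \<open>r * G (y 0)\<close> is left.\<close>
  also have "\<dots> \<le> r * G Y" unfolding T_def G_def by (rule form[OF Y])
  also have "G Y = (\<Sum>k\<le>m. G (z k))"
  proof -
    have "G Y = (\<integral>x. (\<Sum>k\<le>m. w x * (y k x)\<^sup>2) \<partial>\<pi>)"
      unfolding G_def Y2 by (simp add: sum_distrib_left)
    also have "\<dots> = (\<Sum>k\<le>m. G (y k))" unfolding G_def
      by (intro Bochner_Integration.integral_sum integrable_pi bounded_fun_mult bounded_fun_power2 y w)
    finally show ?thesis by (simp add: cyc)
  qed
  also have "r * \<dots> = r * (\<Sum>k<m. G (z k)) + r * G (z m)"
    by (simp add: lessThan_Suc_atMost[symmetric] distrib_left)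
  finally have "(\<integral>x. w x * u n x \<partial>\<pi>) / r ^ m \<le> r * G (z m)" by simp
  also have "G (z m) = (\<integral>x. w x \<partial>\<pi>)" unfolding G_def z_def y_def u0 by simp
  finally show ?thesis using r unfolding Suc by (simp add: field_simps)
qed

text \<open>With \<open>g = w v\<close>, the gap bound leaves
  \<open>(1 - l) * (\<integral>g)\<^sup>2\<close> to be dominated by the integral of
  \<open>(r - l * w) * w * v\<^sup>2\<close>. Weighted Cauchy-Schwarz reduces this to
  \<open>(1 - l) * Q \<le> 1\<close>, which the chord bound reduces further to the two-point case
  with the mean of \<open>f\<close>.\<close>

lemma spectral_gap_tilted_form:
  fixes f v :: "'a \<Rightarrow> real" and s l :: real
  assumes gap: "has_right_spectral_gap \<pi> P lr" and l_def: "l = real_of_ereal (max lr 0)"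
    and f: "f \<in> borel_measurable S" "\<And>x. x \<in> space S \<Longrightarrow> f x \<in> {0..1}" and s: "0 < s"
    and w_def: "w = (\<lambda>x. exp (s * f x))"
    and r_def: "r = exp (s * (\<integral>x. f x \<partial>\<pi>) + alpha l * s\<^sup>2 / 8)"
    and v: "v \<in> bounded_fun S"
  shows "(\<integral>x. transition_op P (\<lambda>y. w y * v y) x * (w x * v x) \<partial>\<pi>) \<le> r * (\<integral>x. w x * (v x)\<^sup>2 \<partial>\<pi>)"
proof -
  have l: "0 \<le> l" "l < 1"
    using right_spectral_gap_real[OF gap] unfolding l_def by simp_all
  note [measurable] = f(1)
  have fb: "f \<in> bounded_fun S" using f by (intro bounded_funI[of _ _ 1]) auto
  have w: "w \<in> bounded_fun S"
    unfolding w_def using f(2) s by (intro bounded_funI[of _ _ "exp s"]) (auto simp: mult_left_le)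
  define m where "m = (\<integral>x. f x \<partial>\<pi>)"
  have m: "0 \<le> m" "m \<le> 1"
    unfolding m_def using f(2) integrable_pi[OF fb]
    by (auto intro!: integral_nonneg_AE integral_le_const AE_I2)
  note LP = Leon_Perron_two_point[OF l s m, folded r_def[folded m_def]]
  \<comment> \<open>\<open>A\<close> and \<open>B\<close> are the values of
    \<open>w / (r - l * w)\<close> at reward 1 and at reward 0, the ends of the chord.\<close>
  define A where "A = exp s / (r - l * exp s)"
  define B where "B = 1 / (r - l)"
  have pt: "l * w x < r" "w x / (r - l * w x) \<le> f x * A + (1 - f x) * B" "0 < w x" if "x \<in> space S" for x
    using ratio_le_chord[OF l(1) LP(1), of "f x"] s f(2)[OF that]
    unfolding w_def A_def B_def by auto
  have "l * w x \<le> l * exp s" if "x \<in> space S" for x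
    unfolding w_def using l s f(2)[OF that] by (intro mult_left_mono) (auto simp: mult_left_le)
  then have dlow: "r - l * exp s \<le> r - l * w x" if "x \<in> space S" for x using that by force
  have q: "(\<lambda>x. w x / (r - l * w x)) \<in> bounded_fun S"
  proof (rule bounded_funI)
    show "(\<lambda>x. w x / (r - l * w x)) \<in> borel_measurable S" unfolding w_def by measurable
    fix x assume x: "x \<in> space S"
    have "w x \<le> exp s" unfolding w_def using s f(2)[OF x] by (auto simp: mult_left_le)
    then have "w x / (r - l * w x) \<le> exp s / (r - l * exp s)"
      using dlow[OF x] LP(1) pt(3)[OF x] by (intro frac_le) auto
    then show "\<bar>w x / (r - l * w x)\<bar> \<le> exp s / (r - l * exp s)"
      using pt[OF x] by simp
  qed
  define g where "g = (\<lambda>x. w x * v x)"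
  have g: "g \<in> bounded_fun S" unfolding g_def by (intro bounded_fun_mult w v)
  define c where "c = (\<integral>x. g x \<partial>\<pi>)"
  define Q where "Q = (\<integral>x. w x / (r - l * w x) \<partial>\<pi>)"
  have wv: "(\<lambda>x. w x * (v x)\<^sup>2) \<in> bounded_fun S" by (intro bounded_fun_mult bounded_fun_power2 w v)
  have "(1 - l) * Q \<le> 1"
  proof -
    have "Q \<le> (\<integral>x. f x * A + (1 - f x) * B \<partial>\<pi>)"
      unfolding Q_def using pt(2)
      by (intro integral_mono integrable_pi q bounded_fun_add bounded_fun_mult bounded_fun_diff fb bounded_fun_const) auto
    also have "\<dots> = m * A + (1 - m) * B"
      using integrable_pi[OF fb] by (simp add: m_def prob_space_S left_diff_distrib)
    finally have "(1 - l) * Q \<le> (1 - l) * (m * A + (1 - m) * B)"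
      using l by (intro mult_left_mono) auto
    also have "\<dots> \<le> 1" using LP(2) unfolding A_def B_def .
    finally show ?thesis .
  qed
  \<comment> \<open>Cauchy-Schwarz in the form of a pointwise square
    \<open>(d * v x - (1 - l) * c)\<^sup>2\<close>. With this scaling, the term containing
    \<open>Q\<close> costs at most one of the two copies of \<open>c\<^sup>2\<close> after
    integration.\<close>
  have "2 * c\<^sup>2 = (\<integral>x. 2 * c * g x \<partial>\<pi>)"
    unfolding c_def by (simp add: power2_eq_square)
  also have "\<dots> \<le> (\<integral>x. (1 / (1 - l)) * (r * (w x * (v x)\<^sup>2) - l * (g x)\<^sup>2)
      + ((1 - l) * c\<^sup>2) * (w x / (r - l * w x)) \<partial>\<pi>)"
  proof (rule integral_mono)
    show "integrable \<pi> (\<lambda>x. 2 * c * g x)"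
      by (intro integrable_pi bounded_fun_mult bounded_fun_const g)
    show "integrable \<pi> (\<lambda>x. (1 / (1 - l)) * (r * (w x * (v x)\<^sup>2) - l * (g x)\<^sup>2)
      + ((1 - l) * c\<^sup>2) * (w x / (r - l * w x)))"
      by (intro integrable_pi bounded_fun_add bounded_fun_mult[OF bounded_fun_const] bounded_fun_diff wv q
          bounded_fun_power2 g)
    fix x assume "x \<in> space \<pi>"
    then have x: "x \<in> space S" by simp
    define d where "d = r - l * w x"
    have d: "0 < d" "0 < w x" "0 < 1 - l" using pt[OF x] l unfolding d_def by auto
    have "r * (w x * (v x)\<^sup>2) - l * (g x)\<^sup>2 = d * w x * (v x)\<^sup>2"
      unfolding d_def g_def by (simp add: algebra_simps power2_eq_square)
    moreover have "0 \<le> (1 / (1 - l)) * (d * w x * (v x)\<^sup>2) + ((1 - l) * c\<^sup>2) * (w x / d) - 2 * c * (w x * v x)"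
    proof -
      have "(1 / k) * (d * w x * (v x)\<^sup>2) + (k * c\<^sup>2) * (w x / d) - 2 * c * (w x * v x)
        = w x * (d * v x - k * c)\<^sup>2 / (k * d)" if "0 < k" for k
        using d that by (simp add: field_simps power2_eq_square)
      from this[OF d(3)] show ?thesis using d by simp
    qed
    ultimately show "2 * c * g x \<le> (1 / (1 - l)) * (r * (w x * (v x)\<^sup>2) - l * (g x)\<^sup>2)
      + ((1 - l) * c\<^sup>2) * (w x / (r - l * w x))"
      unfolding d_def[symmetric] g_def by simp
  qed
  also have "\<dots> = (1 / (1 - l)) * (r * (\<integral>x. w x * (v x)\<^sup>2 \<partial>\<pi>) - l * (\<integral>x. (g x)\<^sup>2 \<partial>\<pi>))
      + ((1 - l) * c\<^sup>2) * Q"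
  proof -
    have "(\<integral>x. k * (r * a x - l * b x) + e * p x \<partial>\<pi>)
      = k * (r * (\<integral>x. a x \<partial>\<pi>) - l * (\<integral>x. b x \<partial>\<pi>)) + e * (\<integral>x. p x \<partial>\<pi>)"
      if "integrable \<pi> a" "integrable \<pi> b" "integrable \<pi> p" for a b p k e
      using that by simp
    then show ?thesis
      unfolding Q_def using integrable_pi[OF wv] integrable_pi[OF q] integrable_pi[OF bounded_fun_power2[OF g]]
      by blast
  qed
  also have "((1 - l) * c\<^sup>2) * Q \<le> c\<^sup>2"
    using mult_right_mono[OF \<open>(1 - l) * Q \<le> 1\<close>, of "c\<^sup>2"] by (simp add: ac_simps)
  finally have "c\<^sup>2 \<le> (1 / (1 - l)) * (r * (\<integral>x. w x * (v x)\<^sup>2 \<partial>\<pi>) - l * (\<integral>x. (g x)\<^sup>2 \<partial>\<pi>))"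
    by simp
  then have "l * (\<integral>x. (g x)\<^sup>2 \<partial>\<pi>) + (1 - l) * c\<^sup>2 \<le> r * (\<integral>x. w x * (v x)\<^sup>2 \<partial>\<pi>)"
    using l by (simp add: field_simps)
  moreover have "(\<integral>x. transition_op P g x * g x \<partial>\<pi>) \<le> l * (\<integral>x. (g x)\<^sup>2 \<partial>\<pi>) + (1 - l) * c\<^sup>2"
    using spectral_gap_bound[OF gap g] unfolding l_def c_def .
  ultimately show ?thesis unfolding g_def by linarith
qed

text \<open>This accounts for the first reward: \<open>n\<close> rewards involve only
  \<open>n - 1\<close> transitions, and the initial factor has to be bounded by the same
  \<open>r\<close>.\<close>

lemma tilted_mass_le:
  fixes f :: "'a \<Rightarrow> real" and s a :: real
  assumes f: "f \<in> borel_measurable S" "\<And>x. x \<in> space S \<Longrightarrow> f x \<in> {0..1}" and s: "0 < s"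
    and a: "1 \<le> a"
  shows "(\<integral>x. exp (s * f x) \<partial>\<pi>) \<le> exp (s * (\<integral>x. f x \<partial>\<pi>) + a * s\<^sup>2 / 8)"
proof -
  have fb: "f \<in> bounded_fun S" using f by (intro bounded_funI[of _ _ 1]) auto
  have w: "(\<lambda>x. exp (s * f x)) \<in> bounded_fun S"
    using f s by (intro bounded_funI[of _ _ "exp s"]) (auto simp: mult_left_le)
  define m where "m = (\<integral>x. f x \<partial>\<pi>)"
  have m: "0 \<le> m" "m \<le> 1"
    unfolding m_def using f(2) integrable_pi[OF fb]
    by (auto intro!: integral_nonneg_AE integral_le_const AE_I2)
  have "(\<integral>x. exp (s * f x) \<partial>\<pi>) \<le> (\<integral>x. 1 - f x + f x * exp s \<partial>\<pi>)"
    using f(2) integrable_pi[OF w] integrable_pi[OF fb]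
    by (intro integral_mono) (auto intro!: exp_le_chord)
  also have "\<dots> = 1 - m + m * exp s"
    using integrable_pi[OF fb] by (simp add: m_def prob_space_S)
  also have "\<dots> \<le> exp (s * m + s\<^sup>2 / 8)" by (rule Hoeffding_two_point[OF m s])
  also have "\<dots> \<le> exp (s * m + a * s\<^sup>2 / 8)"
    using mult_right_mono[OF a, of "s\<^sup>2"] by simp
  finally show ?thesis unfolding m_def .
qed

end

section \<open>Hoeffding's inequality for stationary Markov chains\<close>

lemma past_subalgebra:
  assumes "\<And>i. 1 \<le> i \<Longrightarrow> X i \<in> M \<rightarrow>\<^sub>M S"
  shows "subalgebra M (past M S X n)"
proof -
  have "(\<Union>i\<in>{1..n}. {X i -` A \<inter> space M |A. A \<in> sets S}) \<subseteq> sets M"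
    using assms by (auto intro: measurable_sets)
  moreover from this have "sigma_sets (space M) (\<Union>i\<in>{1..n}. {X i -` A \<inter> space M |A. A \<in> sets S}) \<subseteq> sets M"
    by (rule sets.sigma_sets_subset)
  ultimately show ?thesis
    unfolding subalgebra_def past_def by (simp add: space_measure_of_conv sets_measure_of_conv)
qed

lemma space_past [simp]: "space (past M S X n) = space M"
  by (simp add: past_def space_measure_of_conv)

lemma measurable_past:
  assumes X: "\<And>i. 1 \<le> i \<Longrightarrow> X i \<in> M \<rightarrow>\<^sub>M S" and i: "i \<in> {1..n}"
  shows "X i \<in> past M S X n \<rightarrow>\<^sub>M S"
proof (rule measurableI)
  show "X i x \<in> space S" if "x \<in> space (past M S X n)" for x
    using that X[of i] i by (auto dest: measurable_space)
  fix A assume A: "A \<in> sets S"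
  have sub: "(\<Union>i\<in>{1..n}. {X i -` A \<inter> space M |A. A \<in> sets S}) \<subseteq> Pow (space M)" by auto
  show "X i -` A \<inter> space (past M S X n) \<in> sets (past M S X n)"
    unfolding space_past unfolding past_def sets_measure_of[OF sub]
    using A by (intro sigma_sets.Basic UN_I[OF i]) auto
qed

lemma stationary_markov_chain_kernel:
  "stationary_markov_chain M S P \<pi> X \<Longrightarrow> invariant_kernel \<pi> S P"
  unfolding stationary_markov_chain_def invariant_kernel_def invariant_kernel_axioms_def
  by (auto simp: space_prob_algebra)

text \<open>The Markov property is given for indicators only. Reweighting the probability by
  \<open>Z\<close> replaces an approximation by simple functions: under the finite measure
  \<open>D\<close>, the indicators say that the law of \<open>X (Suc n)\<close> is the law of
  \<open>X n\<close> followed by \<open>P\<close>, and \<open>h\<close> is then integrated against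
  both sides.\<close>

lemma markov_step:
  assumes M: "prob_space M" and chain: "stationary_markov_chain M S P \<pi> X" and n: "1 \<le> n"
    and Z: "Z \<in> bounded_fun (past M S X n)" "\<And>\<omega>. \<omega> \<in> space M \<Longrightarrow> 0 \<le> Z \<omega>"
    and h: "h \<in> bounded_fun S"
  shows "(\<integral>\<omega>. Z \<omega> * h (X (Suc n) \<omega>) \<partial>M) = (\<integral>\<omega>. Z \<omega> * transition_op P h (X n \<omega>) \<partial>M)"
proof -
  interpret M: prob_space M by fact
  interpret invariant_kernel \<pi> S P using chain by (rule stationary_markov_chain_kernel)
  have X: "\<And>i. 1 \<le> i \<Longrightarrow> X i \<in> M \<rightarrow>\<^sub>M S"
    and markov: "\<And>A. A \<in> sets S \<Longrightarrow> AE \<omega> in M.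
      real_cond_exp M (past M S X n) (\<lambda>\<omega>. indicator A (X (Suc n) \<omega>)) \<omega> = measure (P (X n \<omega>)) A"
    using chain n unfolding stationary_markov_chain_def by blast+
  have X1 [measurable]: "X n \<in> M \<rightarrow>\<^sub>M S" and X2 [measurable]: "X (Suc n) \<in> M \<rightarrow>\<^sub>M S"
    using X n by auto
  have sub: "subalgebra M (past M S X n)" by (rule past_subalgebra[OF X])
  interpret sigma_finite_subalgebra M "past M S X n"
    by (intro finite_measure_subalgebra_is_sigma_finite finite_measure_subalgebra.intro
        finite_measure_subalgebra_axioms.intro M.finite_measure_axioms sub)
  have Zp: "Z \<in> borel_measurable (past M S X n)" using Z(1) by (rule bounded_fun_measurable)
  have Zm [measurable]: "Z \<in> borel_measurable M" by (rule measurable_from_subalg[OF sub Zp])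
  obtain B where B: "0 \<le> B" "\<And>\<omega>. \<omega> \<in> space M \<Longrightarrow> \<bar>Z \<omega>\<bar> \<le> B"
    using Z(1) bounded_funE[of Z "past M S X n"] by (metis space_past)
  have ZM: "Z \<in> bounded_fun M" using B by (intro bounded_funI) auto
  have intM: "integrable M q" if "q \<in> bounded_fun M" for q
    by (rule bounded_fun_integrable[OF M.finite_measure_axioms refl that])
  have XS: "X n \<omega> \<in> space S" "X (Suc n) \<omega> \<in> space S" if "\<omega> \<in> space M" for \<omega>
    using that measurable_space[OF X1] measurable_space[OF X2] by auto
  define D where "D = density M (\<lambda>\<omega>. ennreal (Z \<omega>))"
  have D1 [measurable]: "X n \<in> D \<rightarrow>\<^sub>M S" "X (Suc n) \<in> D \<rightarrow>\<^sub>M S" unfolding D_def by measurable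
  have finD: "finite_measure D"
  proof (rule finite_measureI)
    have "emeasure D (space D) = (\<integral>\<^sup>+\<omega>. ennreal (Z \<omega>) \<partial>M)"
      unfolding D_def by (simp add: emeasure_density cong: nn_integral_cong)
    also have "\<dots> = ennreal (\<integral>\<omega>. Z \<omega> \<partial>M)"
      using Z(2) by (intro nn_integral_eq_integral intM ZM AE_I2)
    finally show "emeasure D (space D) \<noteq> \<infinity>" by simp
  qed
  define \<mu> where "\<mu> = distr D S (X n)"
  have fin_mu: "finite_measure \<mu>" unfolding \<mu>_def by (rule finite_measure.finite_measure_distr[OF finD D1(1)])
  have sp: "space \<mu> = space S" "sets \<mu> = sets S" unfolding \<mu>_def by simp_all
  have kmu [measurable]: "P \<in> \<mu> \<rightarrow>\<^sub>M subprob_algebra S" unfolding \<mu>_def by measurable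
  have "distr D S (X (Suc n)) = \<mu> \<bind> P"
  proof (rule measure_eqI)
    show sets: "sets (distr D S (X (Suc n))) = sets (\<mu> \<bind> P)"
      by (simp, rule sets_bind[symmetric]) (use sets_kernel_eq nonempty sp in auto)
    fix A assume "A \<in> sets (distr D S (X (Suc n)))"
    then have A [measurable]: "A \<in> sets S" by simp
    have iA: "(\<lambda>\<omega>. Z \<omega> * indicator A (X (Suc n) \<omega>)) \<in> bounded_fun M"
      by (intro bounded_fun_mult ZM bounded_funI[of _ _ 1]) (auto split: split_indicator)
    have PA [measurable]: "(\<lambda>x. measure (P x) A) \<in> borel_measurable S"
      using measurable_compose[OF kernel_subprob measurable_measure_subprob_algebra[OF A]] .
    have iP: "(\<lambda>\<omega>. Z \<omega> * measure (P (X n \<omega>)) A) \<in> bounded_fun M"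
    proof (intro bounded_fun_mult ZM bounded_funI[of _ _ 1])
      show "\<bar>measure (P (X n \<omega>)) A\<bar> \<le> 1" if "\<omega> \<in> space M" for \<omega>
        using prob_space.prob_le_1[OF prob_space_kernel[OF XS(1)[OF that]]] by simp
    qed measurable
    have "emeasure (distr D S (X (Suc n))) A = (\<integral>\<^sup>+x. indicator A x \<partial>distr D S (X (Suc n)))"
      by simp
    also have "\<dots> = (\<integral>\<^sup>+\<omega>. ennreal (Z \<omega>) * indicator A (X (Suc n) \<omega>) \<partial>M)"
      unfolding D_def by (simp add: nn_integral_distr nn_integral_density del: nn_integral_indicator)
    also have "\<dots> = (\<integral>\<^sup>+\<omega>. ennreal (Z \<omega> * indicator A (X (Suc n) \<omega>)) \<partial>M)"
      by (intro nn_integral_cong) (auto split: split_indicator)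
    also have "\<dots> = ennreal (\<integral>\<omega>. Z \<omega> * indicator A (X (Suc n) \<omega>) \<partial>M)"
      using Z(2) by (intro nn_integral_eq_integral intM iA AE_I2) auto
    also have "(\<integral>\<omega>. Z \<omega> * indicator A (X (Suc n) \<omega>) \<partial>M)
      = (\<integral>\<omega>. Z \<omega> * real_cond_exp M (past M S X n) (\<lambda>\<omega>. indicator A (X (Suc n) \<omega>)) \<omega> \<partial>M)"
      by (rule real_cond_exp_intg(2)[symmetric, OF intM[OF iA] Zp]) measurable
    also have "\<dots> = (\<integral>\<omega>. Z \<omega> * measure (P (X n \<omega>)) A \<partial>M)"
      by (rule integral_cong_AE) (use markov[OF A] in auto)
    also have "ennreal \<dots> = (\<integral>\<^sup>+\<omega>. ennreal (Z \<omega> * measure (P (X n \<omega>)) A) \<partial>M)"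
      using Z(2) by (intro nn_integral_eq_integral[symmetric] intM iP AE_I2) auto
    also have "\<dots> = (\<integral>\<^sup>+\<omega>. ennreal (Z \<omega>) * emeasure (P (X n \<omega>)) A \<partial>M)"
    proof (intro nn_integral_cong)
      fix \<omega> assume \<omega>: "\<omega> \<in> space M"
      interpret Px: prob_space "P (X n \<omega>)" by (rule prob_space_kernel[OF XS(1)[OF \<omega>]])
      show "ennreal (Z \<omega> * measure (P (X n \<omega>)) A) = ennreal (Z \<omega>) * emeasure (P (X n \<omega>)) A"
        using Z(2)[OF \<omega>] by (simp add: Px.emeasure_eq_measure ennreal_mult)
    qed
    also have "\<dots> = (\<integral>\<^sup>+x. emeasure (P x) A \<partial>\<mu>)"
      unfolding \<mu>_def D_def
      by (simp add: nn_integral_distr nn_integral_density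
          measurable_compose[OF kernel_subprob measurable_emeasure_subprob_algebra])
    also have "\<dots> = emeasure (\<mu> \<bind> P) A"
      by (rule emeasure_bind[symmetric, of _ _ S]) (use nonempty sp in auto)
    finally show "emeasure (distr D S (X (Suc n))) A = emeasure (\<mu> \<bind> P) A" .
  qed
  then have "(\<integral>x. h x \<partial>distr D S (X (Suc n))) = (\<integral>x. h x \<partial>(\<mu> \<bind> P))" by simp
  also have "\<dots> = (\<integral>x. transition_op P h x \<partial>\<mu>)"
    unfolding transition_op_def
  proof -
    obtain C where C: "\<And>x. x \<in> space S \<Longrightarrow> \<bar>h x\<bar> \<le> C" using h by (metis bounded_funE)
    show "(\<integral>x. h x \<partial>(\<mu> \<bind> P)) = (\<integral>x. (\<integral>y. h y \<partial>P x) \<partial>\<mu>)"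
    proof (rule integral_bind[where K=S and B=C and B'=1])
      show "AE x in \<mu>. emeasure (P x) (space (P x)) \<le> ennreal 1"
        by (intro AE_I2) (simp add: sp prob_space.emeasure_space_1[OF prob_space_kernel])
    qed (use C h in \<open>auto simp: bounded_fun_measurable fin_mu\<close>)
  qed
  finally have eq: "(\<integral>x. h x \<partial>distr D S (X (Suc n))) = (\<integral>x. transition_op P h x \<partial>distr D S (X n))"
    unfolding \<mu>_def .
  have [measurable]: "h \<in> borel_measurable S" "transition_op P h \<in> borel_measurable S"
    using h transition_op_bounded[OF h] by (auto intro: bounded_fun_measurable)
  have "(\<integral>x. q x \<partial>distr D S (X i)) = (\<integral>\<omega>. Z \<omega> * q (X i \<omega>) \<partial>M)"
    if [measurable]: "X i \<in> M \<rightarrow>\<^sub>M S" "q \<in> borel_measurable S" for i and q :: "'b \<Rightarrow> real"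
  proof -
    have "X i \<in> D \<rightarrow>\<^sub>M S" unfolding D_def by measurable
    then have "(\<integral>x. q x \<partial>distr D S (X i)) = (\<integral>\<omega>. q (X i \<omega>) \<partial>D)"
      by (rule integral_distr) measurable
    also have "\<dots> = (\<integral>\<omega>. Z \<omega> * q (X i \<omega>) \<partial>M)"
      unfolding D_def by (subst integral_density) (use Z(2) in \<open>auto intro!: AE_I2\<close>)
    finally show ?thesis .
  qed
  with eq show ?thesis by simp
qed

text \<open>Conditioning on the past removes the last factors one at a time until only the
  stationary state \<open>X 1\<close> is left; the power inequality bounds what remains.\<close>

lemma Markov_chain_mgf_le:
  fixes f :: "'a \<Rightarrow> real" and s :: real
  assumes M: "prob_space M" and chain: "stationary_markov_chain M S P \<pi> X"
    and gap: "has_right_spectral_gap \<pi> P lr"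
    and f: "f \<in> borel_measurable S" "\<And>x. x \<in> space S \<Longrightarrow> f x \<in> {0..1}"
    and s: "0 < s" and n: "1 \<le> n"
  defines "a \<equiv> alpha (real_of_ereal (max lr 0))"
  shows "(\<integral>\<omega>. exp (s * (\<Sum>i=1..n. f (X i \<omega>))) \<partial>M)
    \<le> exp (s * (\<integral>x. f x \<partial>\<pi>) + a * s\<^sup>2 / 8) ^ n"
proof -
  interpret invariant_kernel \<pi> S P using chain by (rule stationary_markov_chain_kernel)
  have X: "X i \<in> M \<rightarrow>\<^sub>M S" if "1 \<le> i" for i
    using chain that unfolding stationary_markov_chain_def by blast
  have X1: "distr M S (X 1) = \<pi>" using chain unfolding stationary_markov_chain_def by blast
  have a: "1 \<le> a"
    unfolding a_def using right_spectral_gap_real(2,3)[OF gap] by (rule alpha_ge_1)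
  define r where "r = exp (s * (\<integral>x. f x \<partial>\<pi>) + a * s\<^sup>2 / 8)"
  define w where "w = (\<lambda>x. exp (s * f x))"
  have w: "w \<in> bounded_fun S"
    unfolding w_def using f s by (intro bounded_funI[of _ _ "exp s"]) (auto simp: mult_left_le)
  \<comment> \<open>\<open>u k x\<close> plays the role of the expected product of the weights
    \<open>w\<close> of the next \<open>k\<close> states, given the current state
    \<open>x\<close>.\<close>
  define u where "u = rec_nat (\<lambda>_. 1) (\<lambda>_ v. transition_op P (\<lambda>y. w y * v y))"
  have u0: "u 0 = (\<lambda>_. 1)" and u_Suc: "u (Suc k) = transition_op P (\<lambda>y. w y * u k y)" for k
    unfolding u_def by simp_all
  have u: "u k \<in> bounded_fun S" for k
    by (induction k) (auto simp: u0 u_Suc intro!: transition_op_bounded bounded_fun_mult w)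
  define W where "W n \<omega> = (\<Prod>i=1..n. w (X i \<omega>))" for n \<omega>
  have W: "W n \<in> bounded_fun (past M S X n)" for n
    unfolding W_def[abs_def]
    by (intro bounded_fun_prod bounded_fun_compose[OF w] measurable_past[OF X])
  have W_nn: "0 \<le> W n \<omega>" for n \<omega>
    unfolding W_def w_def by (intro prod_nonneg) simp
  have step: "(\<integral>\<omega>. W (n + k) \<omega> \<partial>M) = (\<integral>\<omega>. W n \<omega> * u k (X n \<omega>) \<partial>M)" if "1 \<le> n" for n k
    using that
  proof (induction k arbitrary: n)
    case 0
    then show ?case by (simp add: u0)
  next
    case (Suc k)
    have "(\<integral>\<omega>. W (n + Suc k) \<omega> \<partial>M) = (\<integral>\<omega>. W (Suc n) \<omega> * u k (X (Suc n) \<omega>) \<partial>M)"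
      using Suc.IH[of "Suc n"] by simp
    also have "\<dots> = (\<integral>\<omega>. W n \<omega> * (\<lambda>y. w y * u k y) (X (Suc n) \<omega>) \<partial>M)"
      unfolding W_def by (simp add: mult.assoc)
    also have "\<dots> = (\<integral>\<omega>. W n \<omega> * transition_op P (\<lambda>y. w y * u k y) (X n \<omega>) \<partial>M)"
      by (rule markov_step[OF M chain Suc.prems W W_nn bounded_fun_mult[OF w u]])
    finally show ?case by (simp only: u_Suc)
  qed
  obtain k where k: "n = Suc k" using n by (cases n) auto
  have "exp (s * (\<Sum>i=1..n. f (X i \<omega>))) = W (1 + k) \<omega>" for \<omega>
    unfolding W_def w_def k by (simp only: sum_distrib_left exp_sum[OF finite_atLeastAtMost] plus_1_eq_Suc)
  then have "(\<integral>\<omega>. exp (s * (\<Sum>i=1..n. f (X i \<omega>))) \<partial>M) = (\<integral>\<omega>. W (1 + k) \<omega> \<partial>M)"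
    by simp
  also have "\<dots> = (\<integral>\<omega>. W 1 \<omega> * u k (X 1 \<omega>) \<partial>M)" by (rule step) simp
  also have "\<dots> = (\<integral>\<omega>. (\<lambda>x. w x * u k x) (X 1 \<omega>) \<partial>M)" by (simp add: W_def)
  also have "\<dots> = (\<integral>x. w x * u k x \<partial>distr M S (X 1))"
    by (rule integral_distr[symmetric, OF X bounded_fun_measurable[OF bounded_fun_mult[OF w u]]]) simp
  also have "\<dots> = (\<integral>x. w x * u k x \<partial>\<pi>)" by (simp only: X1)
  also have "\<dots> \<le> r ^ k * (\<integral>x. w x \<partial>\<pi>)"
  proof (rule power_inequality[OF w _ _ _ u0 u_Suc])
    show "(\<integral>x. transition_op P (\<lambda>y. w y * v y) x * (w x * v x) \<partial>\<pi>) \<le> r * (\<integral>x. w x * (v x)\<^sup>2 \<partial>\<pi>)"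
      if "v \<in> bounded_fun S" for v
      by (rule spectral_gap_tilted_form[OF gap refl f s w_def r_def[unfolded a_def] that])
  qed (simp_all add: w_def r_def)
  also have "\<dots> \<le> r ^ k * r"
    unfolding w_def r_def using tilted_mass_le[OF f s a] by (intro mult_left_mono) auto
  finally show ?thesis unfolding r_def k by (simp add: mult.commute)
qed

lemma Markov_chain_Hoeffding:
  fixes f :: "'a \<Rightarrow> real" and \<epsilon> :: real
  assumes M: "prob_space M" and chain: "stationary_markov_chain M S P \<pi> X"
    and gap: "has_right_spectral_gap \<pi> P lr"
    and f: "f \<in> borel_measurable S" "\<And>x. x \<in> space S \<Longrightarrow> f x \<in> {0..1}"
    and \<epsilon>: "0 \<le> \<epsilon>" and n: "1 \<le> n"
  defines "a \<equiv> alpha (real_of_ereal (max lr 0))"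
  shows "measure M {\<omega>\<in>space M. real n * ((\<integral>x. f x \<partial>\<pi>) + \<epsilon>) \<le> (\<Sum>i=1..n. f (X i \<omega>))}
    \<le> exp (- 2 * real n * \<epsilon>\<^sup>2 / a)"
\<comment> \<open>Here the right side is 1, while the exponent \<open>s\<close> chosen below would
  be 0.\<close>
proof (cases "\<epsilon> = 0")
  case True
  then show ?thesis using prob_space.prob_le_1[OF M] by simp
next
  case False
  interpret M: prob_space M by fact
  have X [measurable]: "X i \<in> M \<rightarrow>\<^sub>M S" if "1 \<le> i" for i
    using chain that unfolding stationary_markov_chain_def by blast
  have a: "1 \<le> a"
    unfolding a_def using right_spectral_gap_real(2,3)[OF gap] by (rule alpha_ge_1)
  \<comment> \<open>The minimiser of \<open>a * s\<^sup>2 / 8 - s * \<epsilon>\<close>, with minimum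
    \<open>- 2 * \<epsilon>\<^sup>2 / a\<close>.\<close>
  define s where "s = 4 * \<epsilon> / a"
  have s: "0 < s" unfolding s_def using a \<epsilon> False by simp
  define m where "m = (\<integral>x. f x \<partial>\<pi>)"
  define F where "F \<omega> = (\<Sum>i=1..n. f (X i \<omega>))" for \<omega>
  have fb: "f \<in> bounded_fun S" using f by (intro bounded_funI[of _ _ 1]) auto
  have Fb: "F \<in> bounded_fun M"
    unfolding F_def[abs_def] by (intro bounded_fun_sum bounded_fun_compose[OF fb X]) simp
  note [measurable] = bounded_fun_measurable[OF Fb]
  obtain B where B: "\<And>\<omega>. \<omega> \<in> space M \<Longrightarrow> \<bar>F \<omega>\<bar> \<le> B" using Fb by (metis bounded_funE)
  have "(\<lambda>\<omega>. exp (s * F \<omega>)) \<in> bounded_fun M"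
    using B s by (intro bounded_funI[of _ _ "exp (s * B)"]) (auto dest!: abs_le_D1 simp: abs_le_iff)
  then have int: "integrable M (\<lambda>\<omega>. exp (s * F \<omega>))"
    by (rule bounded_fun_integrable[OF M.finite_measure_axioms refl])
  define e where "e = s * (real n * (m + \<epsilon>))"
  have "measure M {\<omega>\<in>space M. real n * (m + \<epsilon>) \<le> F \<omega>}
      = measure M {\<omega>\<in>space M. exp e \<le> exp (s * F \<omega>)}"
    unfolding e_def using s by (intro arg_cong[where f="measure M"]) auto
  also have "\<dots> \<le> (\<integral>\<omega>. exp (s * F \<omega>) \<partial>M) / exp e"
    by (rule integral_Markov_inequality_measure[OF int, of "{}"]) auto
  also have "\<dots> \<le> exp (s * m + a * s\<^sup>2 / 8) ^ n / exp e"
    using Markov_chain_mgf_le[OF M chain gap f s n] unfolding F_def m_def a_def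
    by (intro divide_right_mono) auto
  also have "\<dots> = exp (real n * (s * m + a * s\<^sup>2 / 8) - e)"
    by (simp add: exp_diff exp_of_nat_mult)
  also have "real n * (s * m + a * s\<^sup>2 / 8) - e = - 2 * real n * \<epsilon>\<^sup>2 / a"
    unfolding e_def s_def using a by (simp add: field_simps power2_eq_square)
  finally show ?thesis unfolding F_def m_def .
qed

section \<open>Regret of the UCB algorithm\<close>

text \<open>A discrete form of the comparison with the integral of \<open>x powr (- 1 - q)\<close>
  from 1 to infinity: each summand, times \<open>q\<close>, is at most a telescoping difference of
  \<open>x powr - q\<close>, by \<open>ln x \<le> x - 1\<close> and
  \<open>1 + x \<le> exp x\<close>.\<close>

lemma sum_powr_le:
  fixes q :: real
  assumes q: "0 < q" and T: "1 \<le> T"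
  shows "(\<Sum>t=2..T. real t powr (- 1 - q)) \<le> 1 / q"
proof -
  have telescope: "q * t powr (- 1 - q) \<le> (t - 1) powr - q - t powr - q" if t: "1 < t" for t :: real
  proof -
    have pos: "0 < 1 - 1 / t" using t by simp
    then have ne: "1 - 1 / t \<noteq> 0" by linarith
    have "1 + q / t \<le> 1 + - q * ln (1 - 1 / t)"
      using mult_left_mono[OF ln_le_minus_one[OF pos], of q] q by simp
    also have "\<dots> \<le> exp (- q * ln (1 - 1 / t))" by (rule exp_ge_add_one_self)
    also have "\<dots> = (1 - 1 / t) powr - q" by (simp only: powr_def if_not_P[OF ne])
    finally have "t powr - q * (1 + q / t) \<le> t powr - q * (1 - 1 / t) powr - q"
      by (intro mult_left_mono) auto
    also have "\<dots> = (t - 1) powr - q"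
    proof -
      have "t * (1 - 1 / t) = t - 1" using t by (simp add: field_simps)
      with powr_mult[of t "1 - 1 / t" "- q"] show ?thesis by simp
    qed
    finally have "t powr - q + q * (t powr - q / t) \<le> (t - 1) powr - q"
      by (simp add: distrib_left mult.commute)
    moreover have "t powr - q / t = t powr (- 1 - q)"
      using t powr_add[of t "-1" "-q"] by (simp add: powr_minus_divide)
    ultimately show ?thesis by simp
  qed
  have "(\<Sum>t=2..T. q * real t powr (- 1 - q)) \<le> 1 - real T powr - q"
    using T
  proof (induction T rule: dec_induct)
    case base
    then show ?case by simp
  next
    case (step t)
    have "q * real (Suc t) powr (- 1 - q) \<le> real t powr - q - real (Suc t) powr - q"
      using telescope[of "real (Suc t)"] step.hyps by simp
    then show ?case using step by simp
  qed
  also have "\<dots> \<le> 1" by simp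
  finally have "q * (\<Sum>t=2..T. real t powr (- 1 - q)) \<le> 1" by (simp add: sum_distrib_left)
  then show ?thesis using q by (simp add: field_simps)
qed

lemma num_plays_0 [simp]: "num_plays J j 0 \<omega> = 0"
  by (simp add: num_plays_def)

lemma num_plays_Suc: "num_plays J j (Suc s) \<omega> = num_plays J j s \<omega> + (if J (Suc s) \<omega> = j then 1 else 0)"
  by (simp add: num_plays_def)

lemma num_plays_le: "num_plays J j s \<omega> \<le> s"
  by (induction s) (auto simp: num_plays_Suc)

text \<open>Each play made while the count is below \<open>u\<close> raises the count, so at most
  \<open>u\<close> plays are of this kind.\<close>

lemma num_plays_le_threshold:
  "real (num_plays J j T \<omega>)
    \<le> real u + (\<Sum>t=1..T. if J t \<omega> = j \<and> u \<le> num_plays J j (t - 1) \<omega> then 1 else 0)"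
    (is "_ \<le> real u + ?C T")
proof (induction T)
  case (Suc T)
  show ?case
  proof (cases "u \<le> num_plays J j T \<omega>")
    case True
    with Suc show ?thesis by (auto simp: num_plays_Suc)
  next
    case False
    then have "real (num_plays J j (Suc T) \<omega>) \<le> real u" by (simp add: num_plays_Suc)
    moreover have "0 \<le> ?C (Suc T)" by (intro sum_nonneg) auto
    ultimately show ?thesis by linarith
  qed
qed simp

text \<open>If both sample means respected their radii, the index of \<open>j\<close> would be below
  \<open>mj\<close> plus twice its radius, hence below \<open>ms\<close>, and the index of
  \<open>jstar\<close> above \<open>ms\<close>. The random counts are weakened to some
  \<open>m\<close> below \<open>t\<close> in preparation for a union bound.\<close>

lemma ucb_selection_cases:
  fixes c :: real and J :: "nat \<Rightarrow> 'w \<Rightarrow> nat" and X :: "nat \<Rightarrow> nat \<Rightarrow> 'w \<Rightarrow> 'a"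
  defines "b \<equiv> \<lambda>t n. sqrt (c * ln (real t) / (2 * real n))"
  assumes max: "is_arg_max (ucb_index c f X J t \<omega>) (\<lambda>j. j \<in> {1..K}) (J t \<omega>)"
    and js: "jstar \<in> {1..K}" and Jt: "J t \<omega> = j"
    and N: "1 \<le> num_plays J j (t - 1) \<omega>"
    and small: "2 * b t (num_plays J j (t - 1) \<omega>) \<le> ms - mj"
  shows "\<exists>m\<in>{1..t - 1}. sample_mean f X jstar m \<omega> + b t m \<le> ms \<or> mj + b t m \<le> sample_mean f X j m \<omega>"
proof -
  define n where "n = num_plays J j (t - 1) \<omega>"
  define m where "m = num_plays J jstar (t - 1) \<omega>"
  have n: "n \<in> {1..t - 1}" using N num_plays_le[of J j "t - 1" \<omega>] unfolding n_def by simp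
  have le: "ucb_index c f X J t \<omega> jstar \<le> ucb_index c f X J t \<omega> j"
    using max js Jt unfolding is_arg_max_def by (meson not_less)
  have ij: "ucb_index c f X J t \<omega> j = ereal (sample_mean f X j n \<omega> + b t n)"
    using n unfolding ucb_index_def b_def n_def Let_def by simp
  \<comment> \<open>An arm not yet played has infinite index and would beat the finite index of
    \<open>j\<close>.\<close>
  have m0: "m \<noteq> 0"
  proof
    assume "m = 0"
    then have "ucb_index c f X J t \<omega> jstar = \<infinity>" unfolding ucb_index_def m_def Let_def by simp
    with le ij show False by simp
  qed
  then have m: "m \<in> {1..t - 1}" using num_plays_le[of J jstar "t - 1" \<omega>] unfolding m_def by simp
  have "sample_mean f X jstar m \<omega> + b t m \<le> sample_mean f X j n \<omega> + b t n"
    using le m0 unfolding ij unfolding ucb_index_def b_def m_def[symmetric] Let_def by simp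
  with small have "sample_mean f X jstar m \<omega> + b t m \<le> ms \<or> mj + b t n \<le> sample_mean f X j n \<omega>"
    unfolding n_def[symmetric] by linarith
  with m n show ?thesis by blast
qed

lemma ln_of_nat_nonneg: "0 \<le> ln (real t)"
  by (cases "t = 0") (auto intro: ln_ge_zero)

text \<open>The exploration radius is calibrated so that
  \<open>2 * n * b\<^sup>2 / a = (c / a) * ln t\<close>, which makes Hoeffding's bound independent
  of \<open>n\<close>.\<close>

lemma sample_mean_tails:
  fixes f :: "nat \<Rightarrow> 'a \<Rightarrow> real" and c :: real
  assumes M: "prob_space M" and chain: "stationary_markov_chain M (S j) (P j) (\<pi> j) (X j)"
    and gap: "has_right_spectral_gap (\<pi> j) (P j) lr"
    and f: "f j \<in> borel_measurable (S j)" "\<And>x. x \<in> space (S j) \<Longrightarrow> f j x \<in> {0..1}"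
    and c: "0 \<le> c" and t: "1 \<le> t" and n: "1 \<le> n"
  defines "a \<equiv> alpha (real_of_ereal (max lr 0))" and "b \<equiv> sqrt (c * ln (real t) / (2 * real n))"
  shows "measure M {\<omega>\<in>space M. mean_reward \<pi> f j + b \<le> sample_mean f X j n \<omega>} \<le> real t powr - (c / a)"
    and "measure M {\<omega>\<in>space M. sample_mean f X j n \<omega> + b \<le> mean_reward \<pi> f j} \<le> real t powr - (c / a)"
proof -
  interpret invariant_kernel "\<pi> j" "S j" "P j" using chain by (rule stationary_markov_chain_kernel)
  have b: "0 \<le> b" unfolding b_def using c ln_of_nat_nonneg by simp
  have "b\<^sup>2 = c * ln (real t) / (2 * real n)"
    unfolding b_def using c ln_of_nat_nonneg by simp
  then have "- 2 * real n * b\<^sup>2 / a = - (c / a) * ln (real t)" using n by simp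
  then have e: "exp (- 2 * real n * b\<^sup>2 / a) = real t powr - (c / a)"
    using t by (simp add: powr_def)
  have "{\<omega>\<in>space M. mean_reward \<pi> f j + b \<le> sample_mean f X j n \<omega>}
      = {\<omega>\<in>space M. real n * ((\<integral>x. f j x \<partial>\<pi> j) + b) \<le> (\<Sum>i=1..n. f j (X j i \<omega>))}"
    unfolding sample_mean_def mean_reward_def using n by (auto simp: field_simps)
  then show "measure M {\<omega>\<in>space M. mean_reward \<pi> f j + b \<le> sample_mean f X j n \<omega>} \<le> real t powr - (c / a)"
    using Markov_chain_Hoeffding[OF M chain gap f b n, folded a_def] unfolding e by simp
  have fb: "f j \<in> bounded_fun (S j)" using f by (intro bounded_funI[of _ _ 1]) auto
  \<comment> \<open>The lower tail of \<open>f j\<close> is the upper tail of the reward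
    \<open>1 - f j\<close>.\<close>
  have g: "(\<lambda>x. 1 - f j x) \<in> borel_measurable (S j)" "\<And>x. x \<in> space (S j) \<Longrightarrow> 1 - f j x \<in> {0..1}"
    using f by auto
  have int: "(\<integral>x. 1 - f j x \<partial>\<pi> j) = 1 - mean_reward \<pi> f j"
    unfolding mean_reward_def using integrable_pi[OF fb] by (simp add: prob_space_S)
  have "{\<omega>\<in>space M. sample_mean f X j n \<omega> + b \<le> mean_reward \<pi> f j}
      = {\<omega>\<in>space M. real n * ((\<integral>x. 1 - f j x \<partial>\<pi> j) + b) \<le> (\<Sum>i=1..n. 1 - f j (X j i \<omega>))}"
    unfolding sample_mean_def int using n by (auto simp: field_simps sum_subtractf)
  then show "measure M {\<omega>\<in>space M. sample_mean f X j n \<omega> + b \<le> mean_reward \<pi> f j} \<le> real t powr - (c / a)"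
    using Markov_chain_Hoeffding[OF M chain gap g b n, folded a_def] unfolding e by simp
qed

text \<open>Up to the threshold, plays are simply counted; every later play forces a deviation of a
  sample mean. In \<open>c / (c - 2 * a) = 1 + 2 * a / (c - 2 * a)\<close>, the 1 pays for rounding
  the threshold up and the fraction for all deviations.\<close>

lemma ucb_expected_plays_le:
  fixes M :: "'w measure" and f :: "nat \<Rightarrow> 'a \<Rightarrow> real" and c \<Delta> :: real
  assumes M: "prob_space M"
    and chain: "\<And>j. j \<in> {1..K} \<Longrightarrow> stationary_markov_chain M (S j) (P j) (\<pi> j) (X j)"
    and gap: "\<And>j. j \<in> {1..K} \<Longrightarrow> has_right_spectral_gap (\<pi> j) (P j) lr"
    and f: "\<And>j. j \<in> {1..K} \<Longrightarrow> f j \<in> borel_measurable (S j)"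
      "\<And>j x. j \<in> {1..K} \<Longrightarrow> x \<in> space (S j) \<Longrightarrow> f j x \<in> {0..1}"
    and ucb: "ucb_algorithm M K c f X J"
    and js: "jstar \<in> {1..K}" and j: "j \<in> {1..K}"
    and \<Delta>: "\<Delta> = reward_gap \<pi> f jstar j" "0 < \<Delta>" and T: "1 \<le> T"
  defines "a \<equiv> alpha (real_of_ereal (max lr 0))"
  assumes c: "2 * a < c"
  shows "(\<integral>\<omega>. real (num_plays J j T \<omega>) \<partial>M) \<le> 2 * c / \<Delta>\<^sup>2 * ln (real T) + c / (c - 2 * a)"
proof -
  interpret M: prob_space M by fact
  have a: "1 \<le> a"
    unfolding a_def using right_spectral_gap_real(2,3)[OF gap[OF j]] by (rule alpha_ge_1)
  have c0: "0 < c" using a c by linarith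
  \<comment> \<open>For \<open>T > 1\<close> this is the count at which the radius of round
    \<open>T\<close> has shrunk to \<open>\<Delta> / 2\<close>.\<close>
  define L where "L = 2 * c / \<Delta>\<^sup>2 * ln (real T)"
  have L0: "0 \<le> L" unfolding L_def using c0 ln_of_nat_nonneg by simp
  \<comment> \<open>Keeping \<open>u\<close> at least 1 ensures that arm \<open>j\<close> has a
    finite index beyond the threshold; rounding up adds at most 1.\<close>
  define u where "u = nat (max 1 \<lceil>L\<rceil>)"
  have u: "1 \<le> u" "L \<le> real u" "real u \<le> L + 1"
    unfolding u_def using L0 by linarith+
  define b where "b t n = sqrt (c * ln (real t) / (2 * real n))" for t n :: nat
  define ms where "ms = mean_reward \<pi> f jstar"
  define mj where "mj = mean_reward \<pi> f j"
  have gap_eq: "ms - mj = \<Delta>" unfolding \<Delta>(1) reward_gap_def ms_def mj_def ..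
  have small: "2 * b t n \<le> \<Delta>" if "1 \<le> t" "t \<le> T" "u \<le> n" for t n
  proof -
    have n: "L \<le> real n" "0 < real n" using u that by linarith+
    have "2 * c * ln (real t) \<le> 2 * c * ln (real T)" using that c0 by simp
    also have "\<dots> = L * \<Delta>\<^sup>2" unfolding L_def using \<Delta>(2) by simp
    also have "\<dots> \<le> real n * \<Delta>\<^sup>2" using n by (intro mult_right_mono) auto
    finally have "c * ln (real t) / (2 * real n) \<le> (\<Delta> / 2)\<^sup>2"
      using n by (simp add: field_simps power2_eq_square)
    then have "b t n \<le> \<Delta> / 2" unfolding b_def using \<Delta>(2) by (intro real_le_lsqrt) auto
    then show ?thesis by simp
  qed
  define A where "A t m = {\<omega>\<in>space M. sample_mean f X jstar m \<omega> + b t m \<le> ms}" for t m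
  define B where "B t m = {\<omega>\<in>space M. mj + b t m \<le> sample_mean f X j m \<omega>}" for t m
  have sm: "(\<lambda>\<omega>. sample_mean f X i m \<omega>) \<in> borel_measurable M" if i: "i \<in> {1..K}" for i m
  proof -
    have "X i k \<in> M \<rightarrow>\<^sub>M S i" if "1 \<le> k" for k
      using chain[OF i] that unfolding stationary_markov_chain_def by blast
    then have "(\<lambda>\<omega>. f i (X i k \<omega>)) \<in> borel_measurable M" if "k \<in> {1..m}" for k
      using measurable_compose[OF _ f(1)[OF i], of "X i k" M] that by simp
    then show ?thesis unfolding sample_mean_def by (intro borel_measurable_divide borel_measurable_sum) auto
  qed
  have AB [measurable]: "A t m \<in> sets M" "B t m \<in> sets M" for t m
    unfolding A_def B_def using sm[OF js] sm[OF j] by simp_all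
  have prob_AB: "measure M (A t m) \<le> real t powr - (c / a)" "measure M (B t m) \<le> real t powr - (c / a)"
    if "1 \<le> t" "1 \<le> m" for t m
    using sample_mean_tails(2)[where S=S and P=P and \<pi>=\<pi> and X=X and f=f and j=jstar and c=c,
        OF M chain[OF js] gap[OF js] f(1)[OF js] f(2)[OF js] less_imp_le[OF c0] that]
      sample_mean_tails(1)[where S=S and P=P and \<pi>=\<pi> and X=X and f=f and j=j and c=c,
        OF M chain[OF j] gap[OF j] f(1)[OF j] f(2)[OF j] less_imp_le[OF c0] that]
    unfolding A_def B_def b_def ms_def mj_def a_def by simp_all
  \<comment> \<open>All deterministic counts \<open>m\<close> are included, since the true counts
    depend on the rewards. Round 1 is omitted because its range of counts is empty.\<close>
  define R :: "'w \<Rightarrow> real" where "R \<omega> = (\<Sum>t=2..T. \<Sum>m=1..t - 1. indicator (A t m) \<omega> + indicator (B t m) \<omega>)" for \<omega>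
  have iAB: "integrable M (indicat_real (A t m))" "integrable M (indicat_real (B t m))" for t m
    by (auto intro!: integrable_real_indicator simp: less_top[symmetric])
  have R_int: "integrable M R"
    unfolding R_def by (intro Bochner_Integration.integrable_sum Bochner_Integration.integrable_add iAB)
  have pointwise: "real (num_plays J j T \<omega>) \<le> real u + R \<omega>" if \<omega>: "\<omega> \<in> space M" for \<omega>
  proof -
    have summand: "(if J t \<omega> = j \<and> u \<le> num_plays J j (t - 1) \<omega> then 1 else 0)
        \<le> (\<Sum>m=1..t - 1. indicator (A t m) \<omega> + indicator (B t m) \<omega> :: real)"
      if t: "t \<in> {1..T}" for t
    proof (cases "J t \<omega> = j \<and> u \<le> num_plays J j (t - 1) \<omega>")
      case True
      have "is_arg_max (ucb_index c f X J t \<omega>) (\<lambda>j. j \<in> {1..K}) (J t \<omega>)"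
        using ucb t \<omega> unfolding ucb_algorithm_def by simp
      from ucb_selection_cases[OF this js, of j ms mj]
      obtain m where m: "m \<in> {1..t - 1}"
        "sample_mean f X jstar m \<omega> + b t m \<le> ms \<or> mj + b t m \<le> sample_mean f X j m \<omega>"
        using True u(1) small[of t "num_plays J j (t - 1) \<omega>"] t unfolding b_def gap_eq by auto
      have "1 \<le> indicator (A t m) \<omega> + (indicator (B t m) \<omega> :: real)"
        using m(2) \<omega> unfolding A_def B_def by (auto split: split_indicator)
      also have "\<dots> \<le> (\<Sum>m=1..t - 1. indicator (A t m) \<omega> + indicator (B t m) \<omega>)"
        using m(1) by (intro member_le_sum) auto
      finally show ?thesis using True by simp
    qed (auto intro: sum_nonneg)
    have "real (num_plays J j T \<omega>)
        \<le> real u + (\<Sum>t=1..T. if J t \<omega> = j \<and> u \<le> num_plays J j (t - 1) \<omega> then 1 else 0)"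
      by (rule num_plays_le_threshold)
    also have "\<dots> \<le> real u + (\<Sum>t=1..T. \<Sum>m=1..t - 1. indicator (A t m) \<omega> + indicator (B t m) \<omega>)"
      using summand by (intro add_left_mono sum_mono) blast
    also have "\<dots> = real u + R \<omega>"
      unfolding R_def using T by (simp add: sum.atLeast_Suc_atMost numeral_2_eq_2)
    finally show ?thesis .
  qed
  have E_R: "(\<integral>\<omega>. R \<omega> \<partial>M) \<le> 2 * a / (c - 2 * a)"
  proof -
    have "(\<integral>\<omega>. R \<omega> \<partial>M) = (\<Sum>t=2..T. \<Sum>m=1..t - 1. measure M (A t m) + measure M (B t m))"
      unfolding R_def by (simp add: iAB)
    also have "\<dots> \<le> (\<Sum>t=2..T. \<Sum>m=1..t - 1. 2 * real t powr - (c / a))"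
    proof (intro sum_mono)
      fix t m assume "t \<in> {2..T}" "m \<in> {1..t - 1}"
      then show "measure M (A t m) + measure M (B t m) \<le> 2 * real t powr - (c / a)"
        using add_mono[OF prob_AB[of t m]] by simp
    qed
    \<comment> \<open>The \<open>t - 1\<close> possible counts cost one power of \<open>t\<close>;
      the excess \<open>c / a - 2\<close> over the critical exponent is positive by the choice of
      \<open>c\<close>.\<close>
    also have "\<dots> \<le> (\<Sum>t=2..T. 2 * real t powr (- 1 - (c / a - 2)))"
    proof (intro sum_mono)
      fix t assume t: "t \<in> {2..T}"
      have "(\<Sum>m=1..t - 1. 2 * real t powr - (c / a)) = 2 * (real (t - 1) * real t powr - (c / a))" by simp
      also have "\<dots> \<le> 2 * (real t * real t powr - (c / a))"
        by (intro mult_left_mono mult_right_mono) auto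
      also have "real t * real t powr - (c / a) = real t powr (- 1 - (c / a - 2))"
        using t powr_mult_base[of "real t" "- (c / a)"] by simp
      finally show "(\<Sum>m=1..t - 1. 2 * real t powr - (c / a)) \<le> 2 * real t powr (- 1 - (c / a - 2))" .
    qed
    also have "\<dots> = 2 * (\<Sum>t=2..T. real t powr (- 1 - (c / a - 2)))" by (simp only: sum_distrib_left)
    also have "\<dots> \<le> 2 * (1 / (c / a - 2))"
      using a c T by (intro mult_left_mono sum_powr_le) (auto simp: field_simps)
    also have "\<dots> = 2 * a / (c - 2 * a)" using a c by (simp add: field_simps)
    finally show ?thesis .
  qed
  have "(\<integral>\<omega>. real (num_plays J j T \<omega>) \<partial>M) \<le> (\<integral>\<omega>. real u + R \<omega> \<partial>M)"
  proof (rule integral_mono)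
    have [measurable]: "J t \<in> M \<rightarrow>\<^sub>M count_space UNIV" if "t \<in> {1..T}" for t
      using ucb that unfolding ucb_algorithm_def by simp
    have "(\<lambda>\<omega>. num_plays J j T \<omega>) \<in> M \<rightarrow>\<^sub>M count_space UNIV"
      unfolding num_plays_def by measurable
    then have "(\<lambda>\<omega>. real (num_plays J j T \<omega>)) \<in> borel_measurable M" by measurable
    then show "integrable M (\<lambda>\<omega>. real (num_plays J j T \<omega>))"
      by (intro M.integrable_const_bound[of _ "real T"] AE_I2) (auto intro: num_plays_le)
  qed (use R_int pointwise in auto)
  also have "\<dots> = real u + (\<integral>\<omega>. R \<omega> \<partial>M)" using R_int by (simp add: M.prob_space)
  also have "\<dots> \<le> L + 1 + 2 * a / (c - 2 * a)" using u(3) E_R by linarith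
  also have "\<dots> = L + c / (c - 2 * a)" using c by (simp add: field_simps)
  finally show ?thesis unfolding L_def .
qed

theorem theorem6p3:
  fixes M :: "'w measure"
    and S :: "nat \<Rightarrow> 'a measure"
    and P :: "nat \<Rightarrow> 'a \<Rightarrow> 'a measure"
    and \<pi> :: "nat \<Rightarrow> 'a measure"
    and X :: "nat \<Rightarrow> nat \<Rightarrow> 'w \<Rightarrow> 'a"
    and f :: "nat \<Rightarrow> 'a \<Rightarrow> real"
    and J :: "nat \<Rightarrow> 'w \<Rightarrow> nat"
    and K jstar T :: nat
    and c :: real
    and lr :: ereal
  assumes "prob_space M"
    and "\<And>j. j \<in> {1..K} \<Longrightarrow> standard_borel (S j)"
    and "\<And>j. j \<in> {1..K} \<Longrightarrow> stationary_markov_chain M (S j) (P j) (\<pi> j) (X j)"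
    and "\<And>j. j \<in> {1..K} \<Longrightarrow> has_right_spectral_gap (\<pi> j) (P j) lr"
    and "\<And>j. j \<in> {1..K} \<Longrightarrow> f j \<in> borel_measurable (S j)"
    and "\<And>j x. j \<in> {1..K} \<Longrightarrow> x \<in> space (S j) \<Longrightarrow> f j x \<in> {0..1}"
    and "is_arg_max (mean_reward \<pi> f) (\<lambda>j. j \<in> {1..K}) jstar"
    and "ucb_algorithm M K c f X J"
    and "c > 2 * alpha (real_of_ereal (max lr 0))"
    and "T \<ge> 1"
  shows "pseudo_regret M K \<pi> f jstar J T \<le>
    (\<Sum>j\<in>{j\<in>{1..K}. reward_gap \<pi> f jstar j > 0}.
        2 * c / reward_gap \<pi> f jstar j * ln (real T)
        + c * reward_gap \<pi> f jstar j / (c - 2 * alpha (real_of_ereal (max lr 0))))"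
proof -
  define a where "a = alpha (real_of_ereal (max lr 0))"
  define \<Delta> where "\<Delta> = reward_gap \<pi> f jstar"
  define E where "E j = (\<integral>\<omega>. real (num_plays J j T \<omega>) \<partial>M)" for j
  have js: "jstar \<in> {1..K}" and nonneg: "0 \<le> \<Delta> j" if "j \<in> {1..K}" for j
    using assms(7) that unfolding is_arg_max_def \<Delta>_def reward_gap_def by (auto simp: not_less)
  have "pseudo_regret M K \<pi> f jstar J T = (\<Sum>j\<in>{1..K}. \<Delta> j * E j)"
    unfolding pseudo_regret_def \<Delta>_def E_def ..
  \<comment> \<open>Optimal arms, \<open>jstar\<close> among them, have gap 0 and drop out however
    often they are played.\<close>
  also have "\<dots> = (\<Sum>j\<in>{j\<in>{1..K}. 0 < \<Delta> j}. \<Delta> j * E j)"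
    using nonneg by (intro sum.mono_neutral_right) (auto simp: less_le)
  also have "\<dots> \<le> (\<Sum>j\<in>{j\<in>{1..K}. 0 < \<Delta> j}. 2 * c / \<Delta> j * ln (real T) + c * \<Delta> j / (c - 2 * a))"
  proof (rule sum_mono)
    fix j assume "j \<in> {j\<in>{1..K}. 0 < \<Delta> j}"
    then have j: "j \<in> {1..K}" and \<Delta>: "0 < \<Delta> j" by auto
    have "E j \<le> 2 * c / (\<Delta> j)\<^sup>2 * ln (real T) + c / (c - 2 * a)"
      unfolding E_def a_def
      by (rule ucb_expected_plays_le[OF assms(1,3-6,8) js[OF j] j _ \<Delta> assms(10,9)]) (simp_all add: \<Delta>_def)
    then have "\<Delta> j * E j \<le> \<Delta> j * (2 * c / (\<Delta> j)\<^sup>2 * ln (real T) + c / (c - 2 * a))"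
      using \<Delta> by (intro mult_left_mono) auto
    also have "\<dots> = 2 * c / \<Delta> j * ln (real T) + c * \<Delta> j / (c - 2 * a)"
      using \<Delta> by (simp add: distrib_left power2_eq_square)
    finally show "\<Delta> j * E j \<le> 2 * c / \<Delta> j * ln (real T) + c * \<Delta> j / (c - 2 * a)" .
  qed
  finally show ?thesis unfolding a_def \<Delta>_def .
qed

end
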